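(* Let $\mathcal{P}$ be a topological operad such that each $\mathcal{P}(n)/\Sigma_n$, $n\ge 0$, is a Dold space, and let $X$ be a $k$-space which is a path-connected Dold space. Then $$\mathbb{P}(X)=\coprod_{n=0}^\infty\mathcal{P}(n)\times_{\Sigma_n}X^n$$ (the free $\mathcal{P}$-space on $X$) is a Dold space.
   Context: A subset $U$ of a space $X$ is ambiently contractible if the inclusion $U\to X$ is nullhomotopic. A cover $\{U_\alpha\}$ of $X$ (by subsets, not necessarily open) is numerable if there is a partition of unity $\{f_\alpha:X\to[0,1]\}$ whose closed supports form a locally finite family with $\mathrm{Supp}(f_\alpha)\subset U_\alpha$ for all $\alpha$. A Dold space (numerably contractible space) is a space having a numerable cover by ambiently contractible subsets. Everything takes place in the category $k\mathrm{Top}$ of $k$-spaces: $X$ is a $k$-space if a subset $U\subset X$ is open precisely when $f^{-1}(U)$ is open for all continuous maps $f:C\to X$ from compact Hausdorff spaces $C$. Products and operads are formed in $k\mathrm{Top}$; $\Sigma_n$ is the symmetric group. $\mathbb{P}$ is left adjoint to the forgetful functor from $\mathcal{P}$-spaces (algebras over $\mathcal{P}$) to $k\mathrm{Top}$. *)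

theory Defs
  imports "HOL-Analysis.Analysis" "HOL-Combinatorics.Permutations"
begin

section \<open>Quotient topologies\<close>

definition quotient_topology :: "'a topology \<Rightarrow> ('a \<Rightarrow> 'b) \<Rightarrow> 'b topology" where
  "quotient_topology X q =
     topology (\<lambda>U. U \<subseteq> q ` topspace X \<and> openin X {x \<in> topspace X. q x \<in> U})"

lemma openin_quotient_topology:
  "openin (quotient_topology X q) U \<longleftrightarrow>
     U \<subseteq> q ` topspace X \<and> openin X {x \<in> topspace X. q x \<in> U}"
proof -
  let ?L = "\<lambda>U. U \<subseteq> q ` topspace X \<and> openin X {x \<in> topspace X. q x \<in> U}"
  have "istopology ?L"
    unfolding istopology_def
  proof (intro conjI allI impI)
    fix S T assume S: "?L S" and T: "?L T"
    show "S \<inter> T \<subseteq> q ` topspace X" using S by blast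
    have "{x \<in> topspace X. q x \<in> S \<inter> T} = {x \<in> topspace X. q x \<in> S} \<inter> {x \<in> topspace X. q x \<in> T}"
      by blast
    then show "openin X {x \<in> topspace X. q x \<in> S \<inter> T}"
      using S T by (simp add: openin_Int)
  next
    fix \<K> assume K: "\<forall>K\<in>\<K>. ?L K"
    then show "\<Union>\<K> \<subseteq> q ` topspace X" by blast
    have eq: "{x \<in> topspace X. q x \<in> \<Union>\<K>} = (\<Union>K\<in>\<K>. {x \<in> topspace X. q x \<in> K})"
      by blast
    show "openin X {x \<in> topspace X. q x \<in> \<Union>\<K>}"
      unfolding eq
    proof (intro openin_Union)
      fix S assume "S \<in> (\<lambda>K. {x \<in> topspace X. q x \<in> K}) ` \<K>"
      then obtain L where L: "L \<in> \<K>" "S = {x \<in> topspace X. q x \<in> L}"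
        by (rule imageE) iprover
      show "openin X S"
        unfolding L(2) using bspec[OF K L(1)] by (rule conjunct2)
    qed
  qed
  then show ?thesis
    by (simp add: quotient_topology_def topology_inverse')
qed

lemma topspace_quotient_topology [simp]: "topspace (quotient_topology X q) = q ` topspace X"
proof
  show "topspace (quotient_topology X q) \<subseteq> q ` topspace X"
    using openin_topspace[of "quotient_topology X q"]
    unfolding openin_quotient_topology by (rule conjunct1)
  have "{x \<in> topspace X. q x \<in> q ` topspace X} = topspace X"
    by blast
  then have "openin (quotient_topology X q) (q ` topspace X)"
    by (simp add: openin_quotient_topology)
  then show "q ` topspace X \<subseteq> topspace (quotient_topology X q)"
    by (rule openin_subset)
qed

lemma quotient_map_quotient_topology: "quotient_map X (quotient_topology X q) q"
  by (simp add: quotient_map_def openin_quotient_topology)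


section \<open>The category of k-spaces\<close>

text \<open>
  This is not the library's \<open>k_space\<close>, which tests against compact subsets: here the
  tests are the continuous maps out of compact Hausdorff spaces, and the two notions differ
  for spaces that are not Hausdorff.

  HOL cannot quantify over the compact Hausdorff spaces of all types, so the test spaces are
  taken on the type \<open>'a set list set set\<close>. The theorem \<open>k_open_preimage\<close>
  below shows that this type is large enough: a set passing these tests passes the tests by
  compact Hausdorff spaces of any type.
\<close>

definition k_open :: "'a topology \<Rightarrow> 'a set \<Rightarrow> bool" where
  "k_open X U \<longleftrightarrow> U \<subseteq> topspace X \<and>
     (\<forall>(C :: 'a set list set set topology) f.
        compact_space C \<and> Hausdorff_space C \<and> continuous_map C X f \<longrightarrow>
        openin C {z \<in> topspace C. f z \<in> U})"

definition is_k_space :: "'a topology \<Rightarrow> bool" where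
  "is_k_space X \<longleftrightarrow> (\<forall>U. openin X U \<longleftrightarrow> k_open X U)"

lemma k_open_preimage_inj:
  fixes C :: "'c topology" and X :: "'a topology" and g :: "'c \<Rightarrow> 'a set list set set"
  assumes U: "k_open X U" and C: "compact_space C" "Hausdorff_space C"
    and f: "continuous_map C X f" and g: "inj_on g (topspace C)"
  shows "openin C {z \<in> topspace C. f z \<in> U}"
proof -
  define D where "D = quotient_topology C g"
  have hom: "homeomorphic_map C D g"
    unfolding homeomorphic_map_def D_def using g quotient_map_quotient_topology by blast
  then obtain h where h: "homeomorphic_maps C D g h"
    using homeomorphic_map_maps by blast
  have "C homeomorphic_space D"
    using h homeomorphic_space_def by blast
  then have D: "compact_space D" "Hausdorff_space D"
    using C homeomorphic_compact_space homeomorphic_Hausdorff_space by blast+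
  have ch: "continuous_map D C h" and cg: "continuous_map C D g"
    and hg: "\<And>z. z \<in> topspace C \<Longrightarrow> h (g z) = z"
    using h by (auto simp: homeomorphic_maps_def)
  have "continuous_map D X (f \<circ> h)"
    using ch f continuous_map_compose by blast
  then have "openin D {w \<in> topspace D. (f \<circ> h) w \<in> U}"
    using U D unfolding k_open_def by blast
  then have "openin C {z \<in> topspace C. g z \<in> {w \<in> topspace D. (f \<circ> h) w \<in> U}}"
    using cg openin_continuous_map_preimage by blast
  also have "{z \<in> topspace C. g z \<in> {w \<in> topspace D. (f \<circ> h) w \<in> U}} = {z \<in> topspace C. f z \<in> U}"
    using hg continuous_map_image_subset_topspace[OF cg] by auto
  finally show ?thesis .
qed

lemma k_open_specialization:
  fixes X :: "'a topology"
  assumes U: "k_open X U" and x: "x \<in> U" and y: "y \<in> topspace X"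
    and xy: "\<And>V. openin X V \<Longrightarrow> x \<in> V \<Longrightarrow> y \<in> V"
  shows "y \<in> U"
proof -
  define a where "a = (\<lambda>n. 1 / real (Suc n))"
  define S where "S = insert 0 (range a)"
  have lim: "a \<longlonglongrightarrow> 0"
    unfolding a_def by (rule LIMSEQ_Suc[OF lim_1_over_n])
  have cS: "compact S"
    unfolding S_def using lim by (rule compact_sequence_with_limit)
  have "infinite (UNIV :: 'a set list set)"
    using infinite_UNIV_listI[where ?'a = "'a set"] by (simp add: Finite_Set.finite_set)
  then have "infinite (UNIV :: 'a set list set set set)"
    by (simp add: Finite_Set.finite_set)
  then obtain i :: "nat \<Rightarrow> 'a set list set set" where i: "inj i"
    by (meson Finite_Set.finite_set infinite_countable_subset)
  have "countable S"
    by (simp add: S_def)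
  then have inj: "inj_on (i \<circ> to_nat_on S) S"
    using i by (meson comp_inj_on inj_on_subset inj_on_to_nat_on subset_UNIV)
  let ?C = "top_of_set S"
  define f where "f = (\<lambda>z::real. if z = 0 then x else y)"
  have xX: "x \<in> topspace X"
    using U x by (auto simp: k_open_def)
  have ne0: "openin ?C (S - {0})"
    by (metis Diff_eq open_Compl closed_singleton openin_open)
  have "continuous_map ?C X f"
    unfolding continuous_map_def
  proof (intro conjI allI impI)
    show "f \<in> topspace ?C \<rightarrow> topspace X"
      using xX y by (auto simp: f_def)
    fix V assume V: "openin X V"
    show "openin ?C {z \<in> topspace ?C. f z \<in> V}"
    proof (cases "x \<in> V")
      case True
      then have "{z \<in> topspace ?C. f z \<in> V} = topspace ?C"
        using xy[OF V] by (auto simp: f_def)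
      then show ?thesis by (metis openin_topspace)
    next
      case False
      then have "{z \<in> topspace ?C. f z \<in> V} = (if y \<in> V then S - {0} else {})"
        by (auto simp: f_def)
      then show ?thesis using ne0 by simp
    qed
  qed
  then have "openin ?C {z \<in> topspace ?C. f z \<in> U}"
    using k_open_preimage_inj[OF U _ _ _, of ?C f "i \<circ> to_nat_on S"] cS inj
    by (simp add: compact_space_subtopology Hausdorff_space_subtopology)
  then obtain T where T: "open T" "{z \<in> S. f z \<in> U} = S \<inter> T"
    by (auto simp: openin_open)
  have "0 \<in> {z \<in> S. f z \<in> U}"
    using x by (simp add: S_def f_def)
  then have "0 \<in> T"
    unfolding T(2) by blast
  then obtain n where n: "a n \<in> T"
    using topological_tendstoD[OF lim T(1)] eventually_sequentially by auto
  have "a n \<in> S"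
    by (simp add: S_def)
  then have "a n \<in> {z \<in> S. f z \<in> U}"
    unfolding T(2) using n by blast
  then have "f (a n) \<in> U"
    by blast
  then show ?thesis
    by (simp add: f_def a_def)
qed

theorem k_open_preimage:
  fixes C :: "'c topology" and X :: "'a topology"
  assumes U: "k_open X U" and C: "compact_space C" "Hausdorff_space C"
    and f: "continuous_map C X f"
  shows "openin C {z \<in> topspace C. f z \<in> U}"
proof (rule ccontr)
  let ?W = "{z \<in> topspace C. f z \<in> U}"
  assume "\<not> openin C ?W"
  then obtain c where c: "c \<in> ?W" and noO: "\<And>B. openin C B \<Longrightarrow> c \<in> B \<Longrightarrow> \<not> B \<subseteq> ?W"
    by (subst (asm) openin_subopen) blast
  define \<V> where "\<V> = {V. openin X V \<and> f c \<in> V}"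
  have reg: "neighbourhood_base_of (closedin C) C"
    using C compact_Hausdorff_imp_regular_space neighbourhood_base_of_closedin by blast
  have "\<exists>B N. openin C B \<and> closedin C N \<and> c \<in> B \<and> B \<subseteq> N \<and> N \<subseteq> {z \<in> topspace C. f z \<in> V}"
    if "V \<in> \<V>" for V
  proof -
    have "openin C {z \<in> topspace C. f z \<in> V}"
      using that f openin_continuous_map_preimage unfolding \<V>_def by blast
    moreover have "c \<in> {z \<in> topspace C. f z \<in> V}"
      using c that by (auto simp: \<V>_def)
    ultimately show ?thesis
      using reg unfolding neighbourhood_base_of by blast
  qed
  then have "\<forall>V\<in>\<V>. \<exists>p. openin C (fst p) \<and> closedin C (snd p) \<and> c \<in> fst p \<and>
      fst p \<subseteq> snd p \<and> snd p \<subseteq> {z \<in> topspace C. f z \<in> V}"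
    by (simp only: split_paired_Ex fst_conv snd_conv) blast
  then obtain p where p: "\<forall>V\<in>\<V>. openin C (fst (p V)) \<and> closedin C (snd (p V)) \<and>
      c \<in> fst (p V) \<and> fst (p V) \<subseteq> snd (p V) \<and> snd (p V) \<subseteq> {z \<in> topspace C. f z \<in> V}"
    by (rule bchoice[THEN exE])
  define B where "B = (\<lambda>V. fst (p V))"
  define N where "N = (\<lambda>V. snd (p V))"
  have BN: "\<And>V. V \<in> \<V> \<Longrightarrow> openin C (B V)" "\<And>V. V \<in> \<V> \<Longrightarrow> closedin C (N V)"
    "\<And>V. V \<in> \<V> \<Longrightarrow> c \<in> B V" "\<And>V. V \<in> \<V> \<Longrightarrow> B V \<subseteq> N V"
    "\<And>V. V \<in> \<V> \<Longrightarrow> N V \<subseteq> {z \<in> topspace C. f z \<in> V}"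
    using p unfolding B_def N_def by blast+
  have "\<exists>z. z \<in> topspace C \<and> z \<notin> ?W \<and> (\<forall>V \<in> set vs \<inter> \<V>. z \<in> B V)" for vs
  proof -
    let ?O = "\<Inter> (insert (topspace C) (B ` (set vs \<inter> \<V>)))"
    have "openin C ?O"
      by (rule openin_Inter) (use BN(1) in auto)
    moreover have "c \<in> ?O"
      using c BN(3) by auto
    ultimately have "\<not> ?O \<subseteq> ?W"
      by (rule noO)
    then obtain z where z: "z \<in> ?O" "z \<notin> ?W"
      by (meson subsetI)
    then have "z \<in> topspace C" "\<forall>V \<in> set vs \<inter> \<V>. z \<in> B V"
      by simp_all
    with z(2) show ?thesis
      by (intro exI[of _ z] conjI)
  qed
  then have "\<forall>vs. \<exists>z. z \<in> topspace C \<and> z \<notin> ?W \<and> (\<forall>V \<in> set vs \<inter> \<V>. z \<in> B V)"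
    by (rule allI)
  then obtain s where s': "\<forall>vs. s vs \<in> topspace C \<and> s vs \<notin> ?W \<and> (\<forall>V \<in> set vs \<inter> \<V>. s vs \<in> B V)"
    by (rule choice[THEN exE])
  have s: "\<And>vs. s vs \<in> topspace C" "\<And>vs. s vs \<notin> ?W"
    "\<And>vs V. V \<in> set vs \<Longrightarrow> V \<in> \<V> \<Longrightarrow> s vs \<in> B V"
    using s' by blast+
  define K where "K = C closure_of (range s)"
  define g where "g = (\<lambda>p. {A. p \<in> C closure_of (s ` A)})"
  have sK: "s vs \<in> K" for vs
    unfolding K_def using s(1) closure_of_subset[of "range s" C] by auto
  have clK: "closedin C K"
    by (simp add: K_def)
  have inj: "inj_on g K"
  proof (rule inj_onI, rule ccontr)
    fix p q assume pq: "p \<in> K" "q \<in> K" "g p = g q" "p \<noteq> q"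
    have "p \<in> topspace C" "q \<in> topspace C"
      using pq clK closedin_subset by blast+
    then obtain E F where EF: "openin C E" "openin C F" "p \<in> E" "q \<in> F" "disjnt E F"
      using C(2) pq(4) unfolding Hausdorff_space_def by blast
    let ?A = "{vs. s vs \<in> E}"
    have "p \<in> C closure_of (s ` ?A)"
      unfolding in_closure_of
    proof (intro conjI allI impI)
      show "p \<in> topspace C" by fact
      fix T assume T: "p \<in> T \<and> openin C T"
      then have "openin C (T \<inter> E)" "p \<in> T \<inter> E"
        using EF by auto
      then obtain vs where "s vs \<in> T \<inter> E"
        using pq(1) unfolding K_def in_closure_of by blast
      then show "\<exists>y. y \<in> s ` ?A \<and> y \<in> T" by blast
    qed
    moreover have "q \<notin> C closure_of (s ` ?A)"
      using EF unfolding in_closure_of disjnt_def by blast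
    ultimately show False
      using pq(3) unfolding g_def by blast
  qed
  let ?D = "subtopology C K"
  have tD: "topspace ?D = K"
    by (rule topspace_subtopology_subset[OF closedin_subset[OF clK]])
  have D: "compact_space ?D" "Hausdorff_space ?D"
    by (intro compact_space_subtopology closedin_compact_space C clK)
       (intro Hausdorff_space_subtopology C)
  have "openin ?D {z \<in> topspace ?D. f z \<in> U}"
  proof (rule k_open_preimage_inj[OF U D])
    show "continuous_map ?D X f"
      using f by (rule continuous_map_from_subtopology)
    show "inj_on g (topspace ?D)"
      using inj by (simp only: tD)
  qed
  then obtain T where T: "openin C T" "{z \<in> K. f z \<in> U} = T \<inter> K"
    unfolding tD openin_subtopology by blast
  have "K \<inter> \<Inter>(N ` \<V>) \<noteq> {}"
  proof -
    have "compactin C K"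
      using C(1) clK closedin_compact_space by blast
    moreover have "K \<inter> \<Inter>\<F> \<noteq> {}" if F: "finite \<F>" "\<F> \<subseteq> N ` \<V>" for \<F>
    proof -
      obtain \<W> where W: "\<W> \<subseteq> \<V>" "finite \<W>" "\<F> = N ` \<W>"
        using F finite_subset_image by metis
      then obtain vs where vs: "set vs = \<W>"
        using finite_list by blast
      have "s vs \<in> N V" if "V \<in> \<W>" for V
        using s(3)[of V vs] BN(4)[of V] that vs W(1) by blast
      then show ?thesis
        using sK[of vs] W(3) by blast
    qed
    moreover have "\<forall>E \<in> N ` \<V>. closedin C E"
      using BN(2) by blast
    ultimately show ?thesis
      unfolding compactin_fip by blast
  qed
  then obtain d where d: "d \<in> K" "\<And>V. V \<in> \<V> \<Longrightarrow> d \<in> N V"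
    by blast
  have fd: "f d \<in> V" if "openin X V" "f c \<in> V" for V
    using BN(5)[of V] d(2)[of V] that unfolding \<V>_def by blast
  have "d \<in> topspace C"
    using d(1) clK closedin_subset by blast
  then have "f d \<in> topspace X"
    using f continuous_map_image_subset_topspace by blast
  then have "f d \<in> U"
    using k_open_specialization[OF U, of "f c" "f d"] c fd by blast
  then have "d \<in> T"
    using T(2) d(1) by blast
  then obtain vs where "s vs \<in> T"
    using d(1) T(1) unfolding K_def in_closure_of by blast
  then have "f (s vs) \<in> U"
    using T(2) sK by blast
  then show False
    using s(1,2) by blast
qed

lemma openin_imp_k_open:
  assumes "openin X U"
  shows "k_open X U"
  unfolding k_open_def
proof (intro conjI allI impI)
  show "U \<subseteq> topspace X"
    using assms by (rule openin_subset)
  fix C :: "'a set list set set topology" and f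
  assume "compact_space C \<and> Hausdorff_space C \<and> continuous_map C X f"
  then have "continuous_map C X f" by simp
  then show "openin C {z \<in> topspace C. f z \<in> U}"
    using assms by (rule openin_continuous_map_preimage)
qed

definition k_coreflection :: "'a topology \<Rightarrow> 'a topology" where
  "k_coreflection X = topology (k_open X)"

lemma openin_k_coreflection: "openin (k_coreflection X) U \<longleftrightarrow> k_open X U"
proof -
  have "istopology (k_open X)"
    unfolding istopology_def
  proof (intro conjI allI impI)
    fix S T assume ST: "k_open X S" "k_open X T"
    show "k_open X (S \<inter> T)"
      unfolding k_open_def
    proof (intro conjI allI impI)
      show "S \<inter> T \<subseteq> topspace X" using ST by (auto simp: k_open_def)
      fix C :: "'a set list set set topology" and f
      assume C: "compact_space C \<and> Hausdorff_space C \<and> continuous_map C X f"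
      have "{z \<in> topspace C. f z \<in> S \<inter> T} = {z \<in> topspace C. f z \<in> S} \<inter> {z \<in> topspace C. f z \<in> T}"
        by blast
      moreover have "openin C {z \<in> topspace C. f z \<in> S}" "openin C {z \<in> topspace C. f z \<in> T}"
        using C ST unfolding k_open_def by blast+
      ultimately show "openin C {z \<in> topspace C. f z \<in> S \<inter> T}"
        by (simp only: openin_Int)
    qed
  next
    fix \<K> assume K: "\<forall>S\<in>\<K>. k_open X S"
    show "k_open X (\<Union>\<K>)"
      unfolding k_open_def
    proof (intro conjI allI impI)
      show "\<Union>\<K> \<subseteq> topspace X" using K by (auto simp: k_open_def)
      fix C :: "'a set list set set topology" and f
      assume C: "compact_space C \<and> Hausdorff_space C \<and> continuous_map C X f"
      have eq: "{z \<in> topspace C. f z \<in> \<Union>\<K>} = (\<Union>S\<in>\<K>. {z \<in> topspace C. f z \<in> S})"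
        by blast
      show "openin C {z \<in> topspace C. f z \<in> \<Union>\<K>}"
        unfolding eq
      proof (intro openin_Union)
        fix L assume "L \<in> (\<lambda>S. {z \<in> topspace C. f z \<in> S}) ` \<K>"
        then obtain S where S: "S \<in> \<K>" "L = {z \<in> topspace C. f z \<in> S}"
          by (rule imageE) iprover
        show "openin C L"
          unfolding S(2) using bspec[OF K S(1)] C unfolding k_open_def by iprover
      qed
    qed
  qed
  then show ?thesis
    by (simp add: k_coreflection_def topology_inverse')
qed

lemma topspace_k_coreflection [simp]: "topspace (k_coreflection X) = topspace X"
proof
  have "k_open X (topspace (k_coreflection X))"
    using openin_topspace[of "k_coreflection X"] by (simp only: openin_k_coreflection)
  then show "topspace (k_coreflection X) \<subseteq> topspace X"
    by (simp add: k_open_def)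
  show "topspace X \<subseteq> topspace (k_coreflection X)"
    by (intro openin_subset) (simp add: openin_k_coreflection openin_imp_k_open)
qed

lemma is_k_space_iff: "is_k_space X \<longleftrightarrow> k_coreflection X = X"
  by (auto simp: is_k_space_def topology_eq openin_k_coreflection)

lemma continuous_map_k_coreflection:
  assumes "compact_space C" "Hausdorff_space C"
  shows "continuous_map C (k_coreflection X) f \<longleftrightarrow> continuous_map C X f"
proof
  assume f: "continuous_map C (k_coreflection X) f"
  show "continuous_map C X f"
    unfolding continuous_map_def
  proof (intro conjI allI impI)
    show "f \<in> topspace C \<rightarrow> topspace X"
      using f by (simp add: continuous_map_def)
    fix U assume "openin X U"
    then have "openin (k_coreflection X) U"
      by (simp add: openin_k_coreflection openin_imp_k_open)
    with f show "openin C {x \<in> topspace C. f x \<in> U}"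
      by (rule openin_continuous_map_preimage)
  qed
next
  assume f: "continuous_map C X f"
  show "continuous_map C (k_coreflection X) f"
    unfolding continuous_map_def openin_k_coreflection
  proof (intro conjI allI impI)
    show "f \<in> topspace C \<rightarrow> topspace (k_coreflection X)"
      using f by (simp add: continuous_map_def)
    fix U assume "k_open X U"
    then show "openin C {x \<in> topspace C. f x \<in> U}"
      using assms f by (rule k_open_preimage)
  qed
qed

lemma is_k_space_k_coreflection: "is_k_space (k_coreflection X)"
  unfolding is_k_space_def openin_k_coreflection
  by (simp add: k_open_def continuous_map_k_coreflection cong: conj_cong)

definition k_prod_topology :: "'a topology \<Rightarrow> 'b topology \<Rightarrow> ('a \<times> 'b) topology" where
  "k_prod_topology X Y = k_coreflection (prod_topology X Y)"

definition k_product_topology :: "('i \<Rightarrow> 'a topology) \<Rightarrow> 'i set \<Rightarrow> ('i \<Rightarrow> 'a) topology" where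
  "k_product_topology X I = k_coreflection (product_topology X I)"


section \<open>Dold spaces\<close>

definition closed_support :: "'a topology \<Rightarrow> ('a \<Rightarrow> real) \<Rightarrow> 'a set" where
  "closed_support X f = X closure_of {x \<in> topspace X. f x \<noteq> 0}"

text \<open>
  Local finiteness is that of the indexed family of supports: \<open>locally_finite_in\<close>,
  applied to the set of supports, would allow infinitely many indices with the same support.
\<close>

definition numerable_cover :: "'a topology \<Rightarrow> 'i set \<Rightarrow> ('i \<Rightarrow> 'a set) \<Rightarrow> bool" where
  "numerable_cover X I U \<longleftrightarrow>
     (\<Union>i\<in>I. U i) = topspace X \<and>
     (\<exists>f :: 'i \<Rightarrow> 'a \<Rightarrow> real.
        (\<forall>i\<in>I. continuous_map X (top_of_set {0..1}) (f i)) \<and>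
        (\<forall>x\<in>topspace X. (\<Sum>i | i \<in> I \<and> f i x \<noteq> 0. f i x) = 1) \<and>
        (\<forall>x\<in>topspace X. \<exists>V. openin X V \<and> x \<in> V \<and>
           finite {i \<in> I. closed_support X (f i) \<inter> V \<noteq> {}}) \<and>
        (\<forall>i\<in>I. closed_support X (f i) \<subseteq> U i))"

text \<open>
  \<open>U\<close> carries the subspace topology, which need not be a k-space topology. For a k-space \<open>X\<close>
  this does not affect \<open>Dold_space\<close>: the members of a numerable cover can be replaced by the
  closed supports they contain, and closed subspaces of k-spaces are k-spaces.
\<close>

definition ambiently_contractible :: "'a topology \<Rightarrow> 'a set \<Rightarrow> bool" where
  "ambiently_contractible X U \<longleftrightarrow>
     U \<subseteq> topspace X \<and> (\<exists>a. homotopic_with (\<lambda>_. True) (subtopology X U) X id (\<lambda>_. a))"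

text \<open>
  The cover is a set of subsets, indexed by itself; \<open>Dold_spaceI\<close> shows that this is no
  restriction on the index sets.
\<close>

definition Dold_space :: "'a topology \<Rightarrow> bool" where
  "Dold_space X \<longleftrightarrow>
     (\<exists>\<U>. numerable_cover X \<U> (\<lambda>U. U) \<and> (\<forall>U\<in>\<U>. ambiently_contractible X U))"

lemma in_closed_support: "x \<in> topspace X \<Longrightarrow> f x \<noteq> 0 \<Longrightarrow> x \<in> closed_support X f"
  using closure_of_subset[of "{x \<in> topspace X. f x \<noteq> 0}" X] by (auto simp: closed_support_def)

theorem Dold_spaceI:
  fixes X :: "'a topology" and I :: "'i set"
  assumes nc: "numerable_cover X I U"
    and ac: "\<And>i. i \<in> I \<Longrightarrow> ambiently_contractible X (U i)"
  shows "Dold_space X"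
proof -
  obtain f where cover: "(\<Union>i\<in>I. U i) = topspace X"
    and cf: "\<And>i. i \<in> I \<Longrightarrow> continuous_map X (top_of_set {0..1::real}) (f i)"
    and sum1: "\<And>x. x \<in> topspace X \<Longrightarrow> (\<Sum>i | i \<in> I \<and> f i x \<noteq> 0. f i x) = 1"
    and lf: "\<forall>x\<in>topspace X. \<exists>V. openin X V \<and> x \<in> V \<and>
           finite {i \<in> I. closed_support X (f i) \<inter> V \<noteq> {}}"
    and supp: "\<And>i. i \<in> I \<Longrightarrow> closed_support X (f i) \<subseteq> U i"
    using nc unfolding numerable_cover_def by (elim conjE exE) blast
  obtain V where V: "\<forall>x\<in>topspace X. openin X (V x) \<and> x \<in> V x \<and>
           finite {i \<in> I. closed_support X (f i) \<inter> V x \<noteq> {}}"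
    using lf by (rule bchoice[THEN exE])
  define J where "J = (\<lambda>x. {i \<in> I. closed_support X (f i) \<inter> V x \<noteq> {}})"
  have opV: "openin X (V x)" and xV: "x \<in> V x" and finJ: "finite (J x)"
    if "x \<in> topspace X" for x
    using V that by (simp_all add: J_def)
  have VX: "V x \<subseteq> topspace X" if "x \<in> topspace X" for x
    using opV[OF that] by (rule openin_subset)
  have JI: "J x \<subseteq> I" for x
    by (auto simp: J_def)
  have nzJ: "i \<in> J x" if "x \<in> topspace X" "y \<in> V x" "i \<in> I" "f i y \<noteq> 0" for x y i
  proof -
    have "y \<in> closed_support X (f i)"
      using subsetD[OF VX[OF that(1)] that(2)] that(4) by (rule in_closed_support)
    then have "closed_support X (f i) \<inter> V x \<noteq> {}"
      using that(2) by (intro notI) (drule equalityD1, blast)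
    then show ?thesis
      unfolding J_def using that(3) by simp
  qed
  have f0: "0 \<le> f i x" if "i \<in> I" "x \<in> topspace X" for i x
    using continuous_map_image_subset_topspace[OF cf[OF that(1)]] that(2) by auto
  define F where "F = (\<lambda>W x. \<Sum>i | i \<in> I \<and> U i = W \<and> f i x \<noteq> 0. f i x)"
  have F_local: "F W y = (\<Sum>i | i \<in> J x \<and> U i = W. f i y)"
    if "x \<in> topspace X" "y \<in> V x" for W x y
    unfolding F_def using finJ[OF that(1)] nzJ[OF that] JI[of x]
    by (intro sum.mono_neutral_left) auto
  have A: "finite {i \<in> I. f i x \<noteq> 0}" if "x \<in> topspace X" for x
    using nzJ[OF that xV[OF that]] finJ[OF that] by (blast intro: finite_subset)
  have F0: "0 \<le> F W x" if "x \<in> topspace X" for W x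
    unfolding F_def using f0 that by (intro sum_nonneg) auto
  have F1: "F W x \<le> 1" if "x \<in> topspace X" for W x
    unfolding F_def sum1[OF that, symmetric]
    using A[OF that] f0[OF _ that] by (intro sum_mono2) auto
  have cF: "continuous_map X euclideanreal (F W)" for W
  proof (rule pasting_lemma[where I = "topspace X" and T = V and
        f = "\<lambda>x y. \<Sum>i | i \<in> J x \<and> U i = W. f i y"])
    fix x assume x: "x \<in> topspace X"
    show "openin X (V x)" using opV[OF x] .
    show "\<exists>j. j \<in> topspace X \<and> x \<in> V j \<and> F W x = (\<Sum>i | i \<in> J j \<and> U i = W. f i x)"
      using x xV F_local by blast
    show "continuous_map (subtopology X (V x)) euclideanreal (\<lambda>y. \<Sum>i | i \<in> J x \<and> U i = W. f i y)"
    proof (intro continuous_map_sum)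
      show "finite {i \<in> J x. U i = W}" using finJ[OF x] by simp
      fix i assume "i \<in> {i \<in> J x. U i = W}"
      then have "continuous_map X euclideanreal (f i)"
        using cf JI[of x] continuous_map_into_fulltopology by blast
      then show "continuous_map (subtopology X (V x)) euclideanreal (f i)"
        by (rule continuous_map_from_subtopology)
    qed
  next
    fix x y z assume "x \<in> topspace X" "y \<in> topspace X" "z \<in> topspace X \<inter> V x \<inter> V y"
    then show "(\<Sum>i | i \<in> J x \<and> U i = W. f i z) = (\<Sum>i | i \<in> J y \<and> U i = W. f i z)"
      using F_local[of x z W] F_local[of y z W] by simp
  qed
  have suppF: "closed_support X (F W) \<subseteq> (\<Union>i\<in>{i \<in> I. U i = W}. closed_support X (f i))" for W
  proof -
    let ?S = "(\<lambda>i. closed_support X (f i)) ` {i \<in> I. U i = W}"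
    have "locally_finite_in X ?S"
      unfolding locally_finite_in_def
    proof (intro conjI ballI)
      show "\<Union> ?S \<subseteq> topspace X"
        by (auto simp: closed_support_def in_closure_of)
      fix x assume x: "x \<in> topspace X"
      have "{T \<in> ?S. T \<inter> V x \<noteq> {}} \<subseteq> (\<lambda>i. closed_support X (f i)) ` J x"
        by (auto simp: J_def)
      then have "finite {T \<in> ?S. T \<inter> V x \<noteq> {}}"
        using finJ[OF x] finite_surj by blast
      then show "\<exists>V. openin X V \<and> x \<in> V \<and> finite {T \<in> ?S. T \<inter> V \<noteq> {}}"
        using opV[OF x] xV[OF x] by blast
    qed
    then have "closedin X (\<Union> ?S)"
      by (rule closedin_locally_finite_Union[rotated]) (erule imageE, simp add: closed_support_def)
    moreover have "{x \<in> topspace X. F W x \<noteq> 0} \<subseteq> \<Union> ?S"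
    proof
      fix x assume x: "x \<in> {x \<in> topspace X. F W x \<noteq> 0}"
      then have "x \<in> topspace X" "F W x \<noteq> 0" by simp_all
      then obtain i where i: "i \<in> I" "U i = W" "f i x \<noteq> 0"
        unfolding F_def by (elim sum.not_neutral_contains_not_neutral) blast
      have "x \<in> closed_support X (f i)"
        using \<open>x \<in> topspace X\<close> i(3) by (rule in_closed_support)
      with i show "x \<in> \<Union> ?S"
        by blast
    qed
    ultimately show ?thesis
      unfolding closed_support_def[of X "F W"] by (intro closure_of_minimal)
  qed
  have "numerable_cover X (U ` I) (\<lambda>U. U)"
    unfolding numerable_cover_def
  proof (intro conjI exI[of _ F] ballI)
    show "(\<Union>W\<in>U ` I. W) = topspace X"
      using cover by simp
    fix W assume "W \<in> U ` I"
    show "continuous_map X (top_of_set {0..1}) (F W)"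
      using cF[of W] F0 F1 by (auto simp: continuous_map_in_subtopology)
    show "closed_support X (F W) \<subseteq> W"
      using suppF[of W] supp by blast
  next
    fix x assume x: "x \<in> topspace X"
    let ?A = "{i \<in> I. f i x \<noteq> 0}"
    have eq: "F W x = (\<Sum>i | i \<in> ?A \<and> U i = W. f i x)" for W
      unfolding F_def by (rule arg_cong[where f = "sum _"]) auto
    have "(\<Sum>W | W \<in> U ` I \<and> F W x \<noteq> 0. F W x) = (\<Sum>W\<in>U ` ?A. F W x)"
    proof (rule sum.mono_neutral_left)
      show "finite (U ` ?A)" using A[OF x] by simp
      show "{W \<in> U ` I. F W x \<noteq> 0} \<subseteq> U ` ?A"
      proof
        fix W assume "W \<in> {W \<in> U ` I. F W x \<noteq> 0}"
        then have "F W x \<noteq> 0" by simp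
        then obtain i where "i \<in> I" "U i = W" "f i x \<noteq> 0"
          unfolding F_def by (elim sum.not_neutral_contains_not_neutral) blast
        then show "W \<in> U ` ?A" by blast
      qed
    qed auto
    also have "\<dots> = (\<Sum>i\<in>?A. f i x)"
      using sum.image_gen[OF A[OF x], of "\<lambda>i. f i x" U] by (simp add: eq)
    also have "\<dots> = 1"
      using sum1[OF x] by simp
    finally show "(\<Sum>W | W \<in> U ` I \<and> F W x \<noteq> 0. F W x) = 1" .
    have "{W \<in> U ` I. closed_support X (F W) \<inter> V x \<noteq> {}} \<subseteq> U ` J x"
    proof
      fix W assume "W \<in> {W \<in> U ` I. closed_support X (F W) \<inter> V x \<noteq> {}}"
      then obtain y where "y \<in> closed_support X (F W)" "y \<in> V x"
        by blast
      then obtain i where "i \<in> I" "U i = W" "y \<in> closed_support X (f i)" "y \<in> V x"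
        using subsetD[OF suppF] by blast
      then show "W \<in> U ` J x"
        unfolding J_def by blast
    qed
    then have "finite {W \<in> U ` I. closed_support X (F W) \<inter> V x \<noteq> {}}"
      using finJ[OF x] finite_surj by blast
    then show "\<exists>V. openin X V \<and> x \<in> V \<and> finite {W \<in> U ` I. closed_support X (F W) \<inter> V \<noteq> {}}"
      using opV[OF x] xV[OF x] by blast
  qed
  then show ?thesis
    unfolding Dold_space_def using ac by blast
qed


section \<open>Topological operads\<close>

text \<open>
  The arities of the inputs of an operadic composition are given by a list \<open>js\<close>; the
  inputs of the composite are numbered from \<open>0\<close> and split into consecutive blocks of
  these lengths.
\<close>

definition block_start :: "nat list \<Rightarrow> nat \<Rightarrow> nat" where
  "block_start js s = sum_list (take s js)"

definition block_of :: "nat list \<Rightarrow> nat \<Rightarrow> nat" where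
  "block_of js m = (LEAST s. m < block_start js (Suc s))"

definition blocks :: "nat list \<Rightarrow> 'a list \<Rightarrow> 'a list list" where
  "blocks js xs = map (\<lambda>s. take (js ! s) (drop (block_start js s) xs)) [0..<length js]"

definition permute_arities :: "nat list \<Rightarrow> (nat \<Rightarrow> nat) \<Rightarrow> nat list" where
  "permute_arities js \<sigma> = map (\<lambda>i. js ! (inv \<sigma> i)) [0..<length js]"

text \<open>
  \<open>block_perm js \<sigma>\<close> moves the block at position \<open>s\<close> to position \<open>\<sigma> s\<close> and keeps the order
  inside the blocks; \<open>block_sum js \<tau>\<close> is the block sum of the permutations \<open>\<tau> 0, \<tau> 1, \<dots>\<close>.
\<close>

definition block_perm :: "nat list \<Rightarrow> (nat \<Rightarrow> nat) \<Rightarrow> nat \<Rightarrow> nat" where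
  "block_perm js \<sigma> m =
     (if m < sum_list js
      then block_start (permute_arities js \<sigma>) (\<sigma> (block_of js m)) +
           (m - block_start js (block_of js m))
      else m)"

definition block_sum :: "nat list \<Rightarrow> (nat \<Rightarrow> nat \<Rightarrow> nat) \<Rightarrow> nat \<Rightarrow> nat" where
  "block_sum js \<tau> m =
     (if m < sum_list js
      then block_start js (block_of js m) +
           \<tau> (block_of js m) (m - block_start js (block_of js m))
      else m)"

text \<open>
  May's definition of a symmetric operad, in the category of k-spaces; no condition is imposed
  on \<open>P 0\<close>. The group \<open>\<Sigma>\<^sub>n\<close> consists of the permutations of \<open>{..<n}\<close>, multiplied by
  composition of functions, and \<open>act n p \<sigma>\<close> is the right action of \<open>\<sigma>\<close> on \<open>p\<close>.
  \<open>compo js c d\<close> is the composite \<open>\<gamma>(c; d 0, \<dots>, d (k - 1))\<close>, where \<open>k = length js\<close> and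
  \<open>d i\<close> has arity \<open>js ! i\<close>.
\<close>

locale topological_operad =
  fixes P :: "nat \<Rightarrow> 'p topology"
    and act :: "nat \<Rightarrow> 'p \<Rightarrow> (nat \<Rightarrow> nat) \<Rightarrow> 'p"
    and unit :: 'p
    and compo :: "nat list \<Rightarrow> 'p \<Rightarrow> (nat \<Rightarrow> 'p) \<Rightarrow> 'p"
  assumes k_space: "is_k_space (P n)"
    and act_continuous:
      "\<sigma> permutes {..<n} \<Longrightarrow> continuous_map (P n) (P n) (\<lambda>p. act n p \<sigma>)"
    and act_id: "p \<in> topspace (P n) \<Longrightarrow> act n p id = p"
    and act_comp:
      "\<lbrakk>p \<in> topspace (P n); \<sigma> permutes {..<n}; \<tau> permutes {..<n}\<rbrakk>
        \<Longrightarrow> act n p (\<sigma> \<circ> \<tau>) = act n (act n p \<sigma>) \<tau>"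
    and unit_in: "unit \<in> topspace (P 1)"
    and compo_continuous:
      "continuous_map
         (k_prod_topology (P (length js)) (k_product_topology (\<lambda>i. P (js ! i)) {..<length js}))
         (P (sum_list js)) (\<lambda>(c, d). compo js c d)"
    and unit_left: "p \<in> topspace (P n) \<Longrightarrow> compo [n] unit (\<lambda>i\<in>{..<1}. p) = p"
    and unit_right:
      "p \<in> topspace (P n) \<Longrightarrow> compo (replicate n 1) p (\<lambda>i\<in>{..<n}. unit) = p"
    and compo_assoc:
      "\<lbrakk>length is = sum_list js; c \<in> topspace (P (length js));
        d \<in> (\<Pi>\<^sub>E s\<in>{..<length js}. topspace (P (js ! s)));
        e \<in> (\<Pi>\<^sub>E m\<in>{..<sum_list js}. topspace (P (is ! m)))\<rbrakk>
        \<Longrightarrow> compo is (compo js c d) e =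
            compo (map sum_list (blocks js is)) c
              (\<lambda>s\<in>{..<length js}.
                 compo (blocks js is ! s) (d s) (\<lambda>r\<in>{..<js ! s}. e (block_start js s + r)))"
    and compo_act_left:
      "\<lbrakk>c \<in> topspace (P (length js)); d \<in> (\<Pi>\<^sub>E s\<in>{..<length js}. topspace (P (js ! s)));
        \<sigma> permutes {..<length js}\<rbrakk>
        \<Longrightarrow> compo js (act (length js) c \<sigma>) d =
            act (sum_list js) (compo (permute_arities js \<sigma>) c (d \<circ> inv \<sigma>)) (block_perm js \<sigma>)"
    and compo_act_right:
      "\<lbrakk>c \<in> topspace (P (length js)); d \<in> (\<Pi>\<^sub>E s\<in>{..<length js}. topspace (P (js ! s)));
        \<And>s. s < length js \<Longrightarrow> \<upsilon> s permutes {..<js ! s}\<rbrakk>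
        \<Longrightarrow> compo js c (\<lambda>s\<in>{..<length js}. act (js ! s) (d s) (\<upsilon> s)) =
            act (sum_list js) (compo js c d) (block_sum js \<upsilon>)"


section \<open>The free space over an operad\<close>

definition sym_orbit_space ::
    "(nat \<Rightarrow> 'p topology) \<Rightarrow> (nat \<Rightarrow> 'p \<Rightarrow> (nat \<Rightarrow> nat) \<Rightarrow> 'p) \<Rightarrow> nat \<Rightarrow> 'p set topology" where
  "sym_orbit_space P act n =
     quotient_topology (P n) (\<lambda>p. {act n p \<sigma> | \<sigma>. \<sigma> permutes {..<n}})"

text \<open>
  The left action of \<open>\<sigma>\<close> on \<open>X\<^sup>n\<close> is \<open>x \<mapsto> x \<circ> inv \<sigma>\<close>, so identifying \<open>(p\<sigma>, y)\<close> with \<open>(p, \<sigma>y)\<close>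
  means identifying \<open>(p, x)\<close> with \<open>(p\<sigma>, x \<circ> \<sigma>)\<close>.
\<close>

definition balanced_power ::
    "(nat \<Rightarrow> 'p topology) \<Rightarrow> (nat \<Rightarrow> 'p \<Rightarrow> (nat \<Rightarrow> nat) \<Rightarrow> 'p) \<Rightarrow> 'x topology \<Rightarrow> nat
      \<Rightarrow> ('p \<times> (nat \<Rightarrow> 'x)) set topology" where
  "balanced_power P act X n =
     quotient_topology (k_prod_topology (P n) (k_product_topology (\<lambda>_. X) {..<n}))
       (\<lambda>(p, x). {(act n p \<sigma>, x \<circ> \<sigma>) | \<sigma>. \<sigma> permutes {..<n}})"

definition free_operad_space ::
    "(nat \<Rightarrow> 'p topology) \<Rightarrow> (nat \<Rightarrow> 'p \<Rightarrow> (nat \<Rightarrow> nat) \<Rightarrow> 'p) \<Rightarrow> 'x topology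
      \<Rightarrow> (nat \<times> ('p \<times> (nat \<Rightarrow> 'x)) set) topology" where
  "free_operad_space P act X = sum_topology (balanced_power P act X) UNIV"

end

theory Submission
  imports Defs
begin

text \<open>
  Let \<open>f\<^sub>a\<close> be a partition of unity on \<open>X\<close> whose sets of positivity contract in \<open>X\<close>; as \<open>X\<close> is path
  connected, all contractions can be made to end at the same point \<open>x\<^sub>0\<close>. To a family \<open>\<tau>\<close> of finite
  nonempty sets \<open>\<tau> i\<close> of indices, \<open>i < n\<close>, belongs the open set \<open>W\<^sub>\<tau>\<close> of those \<open>x \<in> X\<^sup>n\<close> at which every
  \<open>f\<^sub>a (x i)\<close> with \<open>a \<in> \<tau> i\<close> exceeds the sum of all the remaining values \<open>f\<^sub>b (x j)\<close>, \<open>b \<notin> \<tau> j\<close>. These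
  sets cover \<open>X\<^sup>n\<close>, and the distinct ones among the translates of \<open>W\<^sub>\<tau>\<close> under the symmetric group are
  disjoint. So on the union of these translates one can choose, continuously and equivariantly, an
  index \<open>a\<close> in the label of each coordinate \<open>x i\<close> and move \<open>x i\<close> to \<open>x\<^sub>0\<close> by the contraction with
  that index. This deforms an open subset of \<open>P(n) \<times>\<^bsub>\<Sigma>\<^esub> X\<^sup>n\<close> into the section \<open>p \<mapsto> [p, x\<^sub>0, \<dots>, x\<^sub>0]\<close>
  over \<open>P(n)/\<Sigma>\<close>; intersected with the preimages of contractible subsets of \<open>P(n)/\<Sigma>\<close> these sets
  become contractible.
\<close>

section \<open>Dold spaces and locally finite families of functions\<close>

text \<open>Local finiteness is asked of the nonvanishing sets and not of their closures. An open
  set that meets a closure meets the set itself, so both conditions agree, and this one passes at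
  once to functions with smaller nonvanishing sets.\<close>

definition locally_finite_supports :: "'a topology \<Rightarrow> 'i set \<Rightarrow> ('i \<Rightarrow> 'a \<Rightarrow> real) \<Rightarrow> bool" where
  "locally_finite_supports X I f \<longleftrightarrow>
     (\<forall>x\<in>topspace X. \<exists>V. openin X V \<and> x \<in> V \<and> finite {i \<in> I. \<exists>y\<in>V. f i y \<noteq> 0})"

lemma locally_finite_supports_finite:
  assumes "locally_finite_supports X I f" "x \<in> topspace X"
  shows "finite {i \<in> I. f i x \<noteq> 0}"
  using assms unfolding locally_finite_supports_def
  by (metis (no_types, lifting) mem_Collect_eq rev_finite_subset subsetI)

lemma locally_finite_supports_subset:
  assumes "locally_finite_supports X I f"
    and "\<And>i x. \<lbrakk>i \<in> I; x \<in> topspace X; g i x \<noteq> 0\<rbrakk> \<Longrightarrow> f i x \<noteq> 0"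
  shows "locally_finite_supports X I g"
  unfolding locally_finite_supports_def
proof
  fix x assume "x \<in> topspace X"
  then obtain V where V: "openin X V" "x \<in> V" "finite {i \<in> I. \<exists>y\<in>V. f i y \<noteq> 0}"
    using assms(1) unfolding locally_finite_supports_def by blast
  have "{i \<in> I. \<exists>y\<in>V. g i y \<noteq> 0} \<subseteq> {i \<in> I. \<exists>y\<in>V. f i y \<noteq> 0}"
    using assms(2) openin_subset[OF V(1)] by blast
  then show "\<exists>V. openin X V \<and> x \<in> V \<and> finite {i \<in> I. \<exists>y\<in>V. g i y \<noteq> 0}"
    using V finite_subset by blast
qed

text \<open>Near a point only finitely many summands are ever nonzero, so there the index set may be
  replaced by a fixed finite one. The resulting finite sums agree on overlaps and can be
  pasted.\<close>

lemma continuous_map_locally_finite_sum: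
  assumes cont: "\<And>i. i \<in> I \<Longrightarrow> continuous_map X euclideanreal (f i)"
    and lf: "locally_finite_supports X I f"
  shows "continuous_map X euclideanreal (\<lambda>x. \<Sum>i | i \<in> I \<and> f i x \<noteq> 0. f i x)"
proof -
  obtain V where V: "\<forall>x\<in>topspace X.
      openin X (V x) \<and> x \<in> V x \<and> finite {i \<in> I. \<exists>y\<in>V x. f i y \<noteq> 0}"
    using lf unfolding locally_finite_supports_def by (rule bchoice[THEN exE])
  define J where "J x = {i \<in> I. \<exists>y\<in>V x. f i y \<noteq> 0}" for x
  have fin: "finite (J x)" if "x \<in> topspace X" for x
    using V that by (simp add: J_def)
  have eq: "(\<Sum>i | i \<in> I \<and> f i y \<noteq> 0. f i y) = (\<Sum>i\<in>J x. f i y)"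
    if "x \<in> topspace X" "y \<in> V x" for x y
    by (rule sum.mono_neutral_left[OF fin[OF that(1)]]) (use that(2) in \<open>auto simp: J_def\<close>)
  show ?thesis
  proof (rule pasting_lemma[where I = "topspace X" and T = V and f = "\<lambda>x y. \<Sum>i\<in>J x. f i y"])
    fix x assume x: "x \<in> topspace X"
    show "openin X (V x)"
      using V x by blast
    show "continuous_map (subtopology X (V x)) euclideanreal (\<lambda>y. \<Sum>i\<in>J x. f i y)"
      by (intro continuous_map_sum fin[OF x] continuous_map_from_subtopology cont)
        (simp add: J_def)
    show "\<exists>j. j \<in> topspace X \<and> x \<in> V j \<and>
        (\<Sum>i | i \<in> I \<and> f i x \<noteq> 0. f i x) = (\<Sum>i\<in>J j. f i x)"
      using x V eq[OF x] by blast
  next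
    fix x y z assume "x \<in> topspace X" "y \<in> topspace X" "z \<in> topspace X \<inter> V x \<inter> V y"
    then show "(\<Sum>i\<in>J x. f i z) = (\<Sum>i\<in>J y. f i z)"
      using eq[of x z] eq[of y z] by simp
  qed
qed

lemma ambiently_contractible_subset:
  assumes "ambiently_contractible X U" "V \<subseteq> U"
  shows "ambiently_contractible X V"
proof -
  obtain a where a: "homotopic_with (\<lambda>_. True) (subtopology X U) X id (\<lambda>_. a)" and U: "U \<subseteq> topspace X"
    using assms by (auto simp: ambiently_contractible_def)
  have "continuous_map (subtopology X V) (subtopology X U) id"
    using assms(2) by (auto simp: continuous_map_in_subtopology)
  from homotopic_with_compose_continuous_map_right[OF a this, where q = "\<lambda>_. True"]
  have "homotopic_with (\<lambda>_. True) (subtopology X V) X id (\<lambda>_. a)"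
    by (simp add: o_def id_def)
  then show ?thesis
    using U assms(2) by (auto simp: ambiently_contractible_def)
qed

text \<open>Of a Dold space only the partition of unity is kept: its sets of positivity lie in the
  closed supports, hence in members of the cover, and inherit ambient contractibility from
  them.\<close>

lemma Dold_space_partition:
  fixes X :: "'a topology"
  assumes "Dold_space X"
  obtains I :: "'a set set" and f
  where "\<And>i. i \<in> I \<Longrightarrow> continuous_map X euclideanreal (f i)"
    and "\<And>i x. i \<in> I \<Longrightarrow> x \<in> topspace X \<Longrightarrow> 0 \<le> f i x"
    and "\<And>x. x \<in> topspace X \<Longrightarrow> (\<Sum>i | i \<in> I \<and> f i x \<noteq> 0. f i x) = 1"
    and "locally_finite_supports X I f"
    and "\<And>i. i \<in> I \<Longrightarrow> ambiently_contractible X {x \<in> topspace X. 0 < f i x}"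
proof -
  obtain I where nc: "numerable_cover X I (\<lambda>U. U)"
    and ac: "\<forall>i\<in>I. ambiently_contractible X i"
    using assms unfolding Dold_space_def by (elim exE conjE)
  obtain f where cf: "\<forall>i\<in>I. continuous_map X (top_of_set {0..1::real}) (f i)"
    and sum1: "\<forall>x\<in>topspace X. (\<Sum>i | i \<in> I \<and> f i x \<noteq> 0. f i x) = 1"
    and lf: "\<forall>x\<in>topspace X. \<exists>V. openin X V \<and> x \<in> V \<and>
           finite {i \<in> I. closed_support X (f i) \<inter> V \<noteq> {}}"
    and supp: "\<forall>i\<in>I. closed_support X (f i) \<subseteq> i"
    using nc unfolding numerable_cover_def by (elim exE conjE)
  show ?thesis
  proof
    show "continuous_map X euclideanreal (f i)" if "i \<in> I" for i
      using cf that continuous_map_into_fulltopology by blast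
    show "0 \<le> f i x" if "i \<in> I" "x \<in> topspace X" for i x
      using continuous_map_image_subset_topspace[OF bspec[OF cf that(1)]] that(2) by auto
    show "locally_finite_supports X I f"
      unfolding locally_finite_supports_def
    proof
      fix x assume "x \<in> topspace X"
      then obtain V where V: "openin X V" "x \<in> V" "finite {i \<in> I. closed_support X (f i) \<inter> V \<noteq> {}}"
        using lf by blast
      have "{i \<in> I. \<exists>y\<in>V. f i y \<noteq> 0} \<subseteq> {i \<in> I. closed_support X (f i) \<inter> V \<noteq> {}}"
        using openin_subset[OF V(1)] in_closed_support[of _ X] by fast
      then show "\<exists>V. openin X V \<and> x \<in> V \<and> finite {i \<in> I. \<exists>y\<in>V. f i y \<noteq> 0}"
        using V finite_subset by blast
    qed
    show "ambiently_contractible X {x \<in> topspace X. 0 < f i x}" if "i \<in> I" for i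
    proof (rule ambiently_contractible_subset[OF bspec[OF ac that]])
      show "{x \<in> topspace X. 0 < f i x} \<subseteq> i"
        using bspec[OF supp that] in_closed_support[of _ X "f i"] by fastforce
    qed
  qed (use sum1 in blast)
qed

text \<open>
  The closed supports are shrunk into the sets where \<open>f i\<close> is positive by passing to
  \<open>max 0 (f i * s - q / 2)\<close>, where \<open>s\<close> is the sum of the \<open>f i\<close> and \<open>q\<close> the sum of their squares.
  At no point do all of these vanish: otherwise multiplying by \<open>f i\<close> and summing would give
  \<open>q * s \<le> q * s / 2\<close>.
\<close>

theorem Dold_space_cozero:
  assumes cont: "\<And>i. i \<in> I \<Longrightarrow> continuous_map X euclideanreal (f i)"
    and pos: "\<And>i x. i \<in> I \<Longrightarrow> x \<in> topspace X \<Longrightarrow> 0 \<le> f i x"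
    and lf: "locally_finite_supports X I f"
    and cov: "\<And>x. x \<in> topspace X \<Longrightarrow> \<exists>i\<in>I. 0 < f i x"
    and ac: "\<And>i. i \<in> I \<Longrightarrow> ambiently_contractible X {x \<in> topspace X. 0 < f i x}"
  shows "Dold_space X"
proof -
  define A where "A x = {i. i \<in> I \<and> f i x \<noteq> 0}" for x
  define s where "s x = (\<Sum>i\<in>A x. f i x)" for x
  define q where "q x = (\<Sum>i\<in>A x. (f i x)\<^sup>2)" for x
  define g where "g i x = max 0 (f i x * s x - q x / 2)" for i x
  have cs: "continuous_map X euclideanreal s"
    using continuous_map_locally_finite_sum[OF cont lf] by (simp add: s_def[abs_def] A_def)
  have "continuous_map X euclideanreal (\<lambda>x. \<Sum>i | i \<in> I \<and> (f i x)\<^sup>2 \<noteq> 0. (f i x)\<^sup>2)"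
    by (intro continuous_map_locally_finite_sum locally_finite_supports_subset[OF lf]
          continuous_intros cont) auto
  then have cq: "continuous_map X euclideanreal q"
    by (simp add: q_def[abs_def] A_def)
  have cg: "continuous_map X euclideanreal (g i)" if "i \<in> I" for i
    unfolding g_def by (intro continuous_intros cont[OF that] cs cq) auto
  have finA: "finite (A x)" if "x \<in> topspace X" for x
    using locally_finite_supports_finite[OF lf that] by (simp add: A_def)
  have qpos: "0 < q x" and spos: "0 < s x" if "x \<in> topspace X" for x
  proof -
    obtain i where i: "i \<in> I" "0 < f i x"
      using cov[OF \<open>x \<in> topspace X\<close>] by blast
    have "i \<in> A x"
      using i by (simp add: A_def)
    then show "0 < q x" "0 < s x"
      unfolding q_def s_def
      by (intro sum_pos2[OF finA[OF that], of i]; use i pos that in \<open>auto simp: A_def\<close>)+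
  qed
  \<comment> \<open>The inequality is weak so that it describes a closed set, which then contains
    the closed support of \<open>h i\<close>.\<close>
  have fpos: "0 < f i x" if "q x / 2 \<le> f i x * s x" "x \<in> topspace X" for i x
  proof -
    have "0 < f i x * s x"
      using that qpos[of x] by linarith
    then show ?thesis
      using spos[OF that(2)] by (simp add: zero_less_mult_iff)
  qed
  have gf: "f i x \<noteq> 0" if "g i x \<noteq> 0" "x \<in> topspace X" for i x
    using fpos[of x i] that by (force simp: g_def max_def split: if_splits)
  have lg: "locally_finite_supports X I g"
    using lf gf by (rule locally_finite_supports_subset)
  define S where "S x = (\<Sum>i | i \<in> I \<and> g i x \<noteq> 0. g i x)" for x
  have cS: "continuous_map X euclideanreal S"
    using continuous_map_locally_finite_sum[OF cg lg] by (simp add: S_def[abs_def])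
  have Spos: "0 < S x" if x: "x \<in> topspace X" for x
  proof -
    have "\<exists>i\<in>I. g i x \<noteq> 0"
    proof (rule ccontr)
      assume "\<not> ?thesis"
      then have le: "f i x * s x \<le> q x / 2" if "i \<in> I" for i
        using that by (fastforce simp: g_def max_def split: if_splits)
      have "q x * s x = (\<Sum>i\<in>A x. f i x * (f i x * s x))"
        by (simp add: q_def sum_distrib_right power2_eq_square mult.assoc)
      also have "\<dots> \<le> (\<Sum>i\<in>A x. f i x * (q x / 2))"
        by (intro sum_mono mult_left_mono le pos x) (auto simp: A_def)
      also have "\<dots> = s x * (q x / 2)"
        by (simp add: s_def sum_distrib_right)
      finally show False
        using mult_pos_pos[OF qpos[OF x] spos[OF x]] by simp
    qed
    then obtain i where "i \<in> I" "g i x \<noteq> 0"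
      by blast
    then show ?thesis
      unfolding S_def using locally_finite_supports_finite[OF lg x]
      by (intro sum_pos2[of _ i]) (auto simp: g_def)
  qed
  define h where "h i x = g i x / S x" for i x
  have h0: "h i x \<noteq> 0 \<longleftrightarrow> g i x \<noteq> 0" if "x \<in> topspace X" for i x
    using Spos[OF that] by (simp add: h_def)
  have gle: "g i x \<le> S x" if "i \<in> I" "x \<in> topspace X" for i x
  proof (cases "g i x = 0")
    case True then show ?thesis using Spos[OF that(2)] by simp
  next
    case False
    then show ?thesis unfolding S_def using that locally_finite_supports_finite[OF lg that(2)]
      by (intro member_le_sum) (auto simp: g_def)
  qed
  have supp: "closed_support X (h i) \<subseteq> {x \<in> topspace X. 0 < f i x}" if i: "i \<in> I" for i
  proof -
    have "closedin X {x \<in> topspace X. f i x * s x - q x / 2 \<in> {0..}}"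
      by (intro closedin_continuous_map_preimage[where Y = euclideanreal] continuous_intros
          cont[OF i] cs cq) auto
    moreover have "{x \<in> topspace X. h i x \<noteq> 0} \<subseteq> {x \<in> topspace X. f i x * s x - q x / 2 \<in> {0..}}"
      by (auto simp: h_def g_def max_def split: if_splits)
    ultimately have "closed_support X (h i) \<subseteq> {x \<in> topspace X. f i x * s x - q x / 2 \<in> {0..}}"
      unfolding closed_support_def by (simp add: closure_of_minimal)
    then show ?thesis
      using fpos by auto
  qed
  have "numerable_cover X I (\<lambda>i. {x \<in> topspace X. 0 < f i x})"
    unfolding numerable_cover_def
  proof (intro conjI exI[of _ h] ballI)
    show "(\<Union>i\<in>I. {x \<in> topspace X. 0 < f i x}) = topspace X"
      using cov by blast
    show "continuous_map X (top_of_set {0..1}) (h i)" if "i \<in> I" for i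
    proof -
      have "continuous_map X euclideanreal (h i)"
        unfolding h_def using Spos by (intro continuous_intros cg that cS) force
      moreover have "h i x \<in> {0..1}" if "x \<in> topspace X" for x
        using Spos[OF that] gle[OF \<open>i \<in> I\<close> that] by (auto simp: h_def g_def)
      ultimately show ?thesis
        by (auto simp: continuous_map_in_subtopology)
    qed
    show "closed_support X (h i) \<subseteq> {x \<in> topspace X. 0 < f i x}" if "i \<in> I" for i
      by (rule supp[OF that])
  next
    fix x assume x: "x \<in> topspace X"
    have "(\<Sum>i | i \<in> I \<and> h i x \<noteq> 0. h i x) = (\<Sum>i | i \<in> I \<and> g i x \<noteq> 0. g i x / S x)"
      by (simp add: h0[OF x]) (simp add: h_def)
    also have "\<dots> = S x / S x"
      by (simp only: S_def sum_divide_distrib)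
    finally show "(\<Sum>i | i \<in> I \<and> h i x \<noteq> 0. h i x) = 1"
      using Spos[OF x] by simp
    obtain V where V: "openin X V" "x \<in> V" "finite {i \<in> I. \<exists>y\<in>V. g i y \<noteq> 0}"
      using lg x unfolding locally_finite_supports_def by blast
    have "{i \<in> I. closed_support X (h i) \<inter> V \<noteq> {}} \<subseteq> {i \<in> I. \<exists>y\<in>V. g i y \<noteq> 0}"
    proof safe
      fix i y assume "i \<in> I" "y \<in> closed_support X (h i)" "y \<in> V"
      then obtain z where "z \<in> topspace X" "h i z \<noteq> 0" "z \<in> V"
        using V(1) unfolding closed_support_def in_closure_of by blast
      then show "\<exists>y\<in>V. g i y \<noteq> 0"
        using h0 by blast
    qed
    then show "\<exists>V. openin X V \<and> x \<in> V \<and> finite {i \<in> I. closed_support X (h i) \<inter> V \<noteq> {}}"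
      using V finite_subset by blast
  qed
  then show ?thesis
    using ac by (rule Dold_spaceI)
qed

text \<open>The functions on each summand are extended by zero and indexed by pairs. Their sets of
  positivity stay inside one summand, where the given contractions are transported along the open
  inclusion.\<close>

theorem Dold_space_sum_topology:
  fixes Y :: "'i \<Rightarrow> 'a topology"
  assumes "\<And>n. n \<in> N \<Longrightarrow> Dold_space (Y n)"
  shows "Dold_space (sum_topology Y N)"
proof -
  \<comment> \<open>One predicate holds all properties of a partition on the summand
    \<open>n\<close>, so that index sets and functions can be chosen together for all
    \<open>n \<in> N\<close>.\<close>
  define D where "D n I f \<longleftrightarrow> (\<forall>i\<in>I. continuous_map (Y n) euclideanreal (f i)) \<and>
      (\<forall>i\<in>I. \<forall>x\<in>topspace (Y n). 0 \<le> f i x) \<and>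
      (\<forall>x\<in>topspace (Y n). (\<Sum>i | i \<in> I \<and> f i x \<noteq> 0. f i x) = 1) \<and>
      locally_finite_supports (Y n) I f \<and>
      (\<forall>i\<in>I. ambiently_contractible (Y n) {x \<in> topspace (Y n). 0 < f i x})"
    for n and I :: "'a set set" and f
  have "\<exists>I f. D n I f" if n: "n \<in> N" for n
    unfolding D_def by (rule Dold_space_partition[OF assms[OF n]]) blast
  then obtain I f where D: "\<And>n. n \<in> N \<Longrightarrow> D n (I n) (f n)"
    by metis
  let ?S = "sum_topology Y N"
  define F where "F = (\<lambda>(n, i) (m, y). if m = n then f n i y else 0)"
  show ?thesis
  proof (rule Dold_space_cozero[where I = "Sigma N I" and f = F])
    fix k assume "k \<in> Sigma N I"
    then obtain n i where k: "k = (n, i)" "n \<in> N" "i \<in> I n" by blast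
    have c: "continuous_map (Y n) euclideanreal (f n i)"
      and ac: "ambiently_contractible (Y n) {x \<in> topspace (Y n). 0 < f n i x}"
      and f0: "\<And>x. x \<in> topspace (Y n) \<Longrightarrow> 0 \<le> f n i x"
      using D[OF k(2)] k(3) by (simp_all add: D_def)
    have "continuous_map (Y m) euclideanreal (\<lambda>y. F k (m, y))" for m
      using c by (cases "m = n") (auto simp: F_def k)
    then have "openin (Y m) {y \<in> topspace (Y m). F k (m, y) \<in> U}" if "open U" for U m
      using that openin_continuous_map_preimage[of "Y m" euclideanreal "\<lambda>y. F k (m, y)" U] by simp
    moreover have "{y. (m, y) \<in> {x \<in> topspace ?S. F k x \<in> U}} = {y \<in> topspace (Y m). F k (m, y) \<in> U}"
      if "m \<in> N" for m U
      using that by auto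
    ultimately show "continuous_map ?S euclideanreal (F k)"
      by (simp add: continuous_map_def openin_sum_topology)
    show "0 \<le> F k x" if "x \<in> topspace ?S" for x
      using that f0 by (auto simp: F_def k)
    let ?W = "{x \<in> topspace ?S. 0 < F k x}" and ?U = "{x \<in> topspace (Y n). 0 < f n i x}"
    have W: "?W = Sigma {n} (\<lambda>_. ?U)"
      using k by (auto simp: F_def split: if_splits)
    then have tW: "topspace (subtopology ?S ?W) = Sigma {n} (\<lambda>_. ?U)"
      by auto
    obtain a where "homotopic_with (\<lambda>_. True) (subtopology (Y n) ?U) (Y n) id (\<lambda>_. a)"
      using ac unfolding ambiently_contractible_def by blast
    moreover have "continuous_map (subtopology ?S ?W) (subtopology (Y n) ?U) snd"
      unfolding continuous_map_in_subtopology
    proof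
      show "continuous_map (subtopology ?S ?W) (Y n) snd"
        unfolding continuous_map_def
      proof (intro conjI allI impI)
        show "snd \<in> topspace (subtopology ?S ?W) \<rightarrow> topspace (Y n)"
          unfolding tW by auto
        fix U assume U: "openin (Y n) U"
        moreover have "Pair n ` U = {n} \<times> U"
          by auto
        ultimately have "openin ?S ({n} \<times> U)"
          using open_map_component_injection[OF k(2), of Y]
          unfolding open_map_def by metis
        moreover have "{x \<in> topspace (subtopology ?S ?W). snd x \<in> U} = ?W \<inter> ({n} \<times> U)"
          unfolding tW unfolding W by auto
        ultimately show "openin (subtopology ?S ?W) {x \<in> topspace (subtopology ?S ?W). snd x \<in> U}"
          by (simp only: openin_subtopology_Int2)
      qed
      show "snd \<in> topspace (subtopology ?S ?W) \<rightarrow> ?U"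
        unfolding tW by auto
    qed
    ultimately have "homotopic_with (\<lambda>_. True) (subtopology ?S ?W) (Y n) (id \<circ> snd) ((\<lambda>_. a) \<circ> snd)"
      by (rule homotopic_with_compose_continuous_map_right) simp
    then have "homotopic_with (\<lambda>_. True) (subtopology ?S ?W) ?S
        (Pair n \<circ> (id \<circ> snd)) (Pair n \<circ> ((\<lambda>_. a) \<circ> snd))"
      by (rule homotopic_with_compose_continuous_map_left)
        (auto intro: continuous_map_component_injection k)
    then have "homotopic_with (\<lambda>_. True) (subtopology ?S ?W) ?S id (\<lambda>_. (n, a))"
      by (rule homotopic_with_eq) (unfold tW, auto)
    then show "ambiently_contractible ?S ?W"
      unfolding ambiently_contractible_def by blast
  next
    show "locally_finite_supports ?S (Sigma N I) F"
      unfolding locally_finite_supports_def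
    proof
      fix x assume "x \<in> topspace ?S"
      then obtain n y where x: "x = (n, y)" "n \<in> N" "y \<in> topspace (Y n)" by auto
      then obtain V where V: "openin (Y n) V" "y \<in> V" "finite {i \<in> I n. \<exists>y\<in>V. f n i y \<noteq> 0}"
        using D[OF x(2)] unfolding D_def locally_finite_supports_def by blast
      have "{k \<in> Sigma N I. \<exists>z\<in>Pair n ` V. F k z \<noteq> 0} \<subseteq> Pair n ` {i \<in> I n. \<exists>y\<in>V. f n i y \<noteq> 0}"
        by (auto simp: F_def image_iff split: if_splits)
      then have "finite {k \<in> Sigma N I. \<exists>z\<in>Pair n ` V. F k z \<noteq> 0}"
        using V(3) finite_surj by blast
      moreover have "openin ?S (Pair n ` V)"
        using open_map_component_injection[OF x(2), of Y] V(1) unfolding open_map_def by blast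
      ultimately show "\<exists>V. openin ?S V \<and> x \<in> V \<and> finite {k \<in> Sigma N I. \<exists>z\<in>V. F k z \<noteq> 0}"
        using x V(2) by blast
    qed
  next
    fix x assume "x \<in> topspace ?S"
    then obtain n y where x: "x = (n, y)" "n \<in> N" "y \<in> topspace (Y n)" by auto
    then have "(\<Sum>i | i \<in> I n \<and> f n i y \<noteq> 0. f n i y) = 1"
      using D[OF x(2)] unfolding D_def by blast
    then have "(\<Sum>i | i \<in> I n \<and> f n i y \<noteq> 0. f n i y) \<noteq> 0"
      by simp
    then obtain i where i: "i \<in> I n" "f n i y \<noteq> 0"
      by (elim sum.not_neutral_contains_not_neutral) blast
    moreover have "0 \<le> f n i y"
      using D[OF x(2)] x(3) i(1) unfolding D_def by blast
    ultimately show "\<exists>k\<in>Sigma N I. 0 < F k x"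
      using x by (intro bexI[of _ "(n, i)"]) (auto simp: F_def)
  qed
qed

text \<open>Since the unit interval is locally compact Hausdorff, its product with the quotient map
  \<open>q\<close> is again a quotient map. A homotopy on \<open>E\<close> that is constant on the
  fibres of \<open>q\<close> at each time therefore descends to \<open>Y\<close>.\<close>

lemma homotopic_with_quotient_map:
  assumes q: "quotient_map E Y q"
    and h: "continuous_map (prod_topology (top_of_set {0..1::real}) E) Z h"
    and fib: "\<And>t x y. \<lbrakk>t \<in> {0..1}; x \<in> topspace E; y \<in> topspace E; q x = q y\<rbrakk> \<Longrightarrow> h (t, x) = h (t, y)"
    and h0: "\<And>x. x \<in> topspace E \<Longrightarrow> h (0, x) = f (q x)"
    and h1: "\<And>x. x \<in> topspace E \<Longrightarrow> h (1, x) = g (q x)"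
  shows "homotopic_with (\<lambda>_. True) Y Z f g"
proof -
  let ?I = "top_of_set {0..1::real}"
  have Q: "quotient_map (prod_topology ?I E) (prod_topology ?I Y) (\<lambda>(x, y). (x, q y))"
    using q by (intro quotient_map_prod_right)
      (auto simp: Hausdorff_space_subtopology compact_space_subtopology
        intro!: compact_imp_locally_compact_space)
  have compat: "h a = h b"
    if "a \<in> topspace (prod_topology ?I E)" "b \<in> topspace (prod_topology ?I E)"
      "(\<lambda>(x, y). (x, q y)) a = (\<lambda>(x, y). (x, q y)) b" for a b
    using that fib[of "fst a" "snd a" "snd b"] by (cases a; cases b) simp
  obtain k where k: "continuous_map (prod_topology ?I Y) Z k"
    "k ` topspace (prod_topology ?I Y) = h ` topspace (prod_topology ?I E)"
    "\<And>z. z \<in> topspace (prod_topology ?I E) \<Longrightarrow> k ((\<lambda>(x, y). (x, q y)) z) = h z"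
    by (rule quotient_map_lift_exists[OF Q h compat]) (assumption | rule that)+
  have "\<forall>y\<in>topspace Y. k (0, y) = f y \<and> k (1, y) = g y"
    unfolding quotient_imp_surjective_map[OF q, symmetric]
    using k(3)[of "(0, _)"] k(3)[of "(1, _)"] h0 h1 by simp
  then show ?thesis
    using k(1) by (subst homotopic_with) (simp, intro exI[of _ k] conjI, simp_all)
qed


section \<open>Maps into products of k-spaces\<close>

text \<open>Composing a test map into \<open>X\<close> with \<open>f\<close> gives a test map into
  \<open>Y\<close>, so \<open>k_open\<close> sets pull back to \<open>k_open\<close> sets.
  \<open>k_open_preimage\<close> enters because the test spaces of \<open>X\<close> may live on
  another type than those of \<open>Y\<close>.\<close>

lemma continuous_map_into_k_coreflection:
  assumes X: "is_k_space X"
  shows "continuous_map X (k_coreflection Y) f \<longleftrightarrow> continuous_map X Y f"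
proof
  assume f: "continuous_map X (k_coreflection Y) f"
  then show "continuous_map X Y f"
    by (auto simp: continuous_map_def openin_k_coreflection openin_imp_k_open)
next
  assume f: "continuous_map X Y f"
  show "continuous_map X (k_coreflection Y) f"
    unfolding continuous_map_def openin_k_coreflection
  proof (intro conjI allI impI)
    show "f \<in> topspace X \<rightarrow> topspace (k_coreflection Y)"
      using f by (simp add: continuous_map_def)
    fix U assume U: "k_open Y U"
    have "k_open X {x \<in> topspace X. f x \<in> U}"
      unfolding k_open_def
    proof (intro conjI allI impI)
      fix C :: "'a set list set set topology" and g
      assume C: "compact_space C \<and> Hausdorff_space C \<and> continuous_map C X g"
      then have "openin C {z \<in> topspace C. (f \<circ> g) z \<in> U}"
        using k_open_preimage[OF U] f continuous_map_compose by blast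
      moreover have "{z \<in> topspace C. g z \<in> {x \<in> topspace X. f x \<in> U}} = {z \<in> topspace C. (f \<circ> g) z \<in> U}"
        using C continuous_map_image_subset_topspace by fastforce
      ultimately show "openin C {z \<in> topspace C. g z \<in> {x \<in> topspace X. f x \<in> U}}"
        by simp
    qed auto
    then show "openin X {x \<in> topspace X. f x \<in> U}"
      using X by (simp add: is_k_space_def)
  qed
qed

lemma continuous_map_from_k_coreflection:
  assumes "continuous_map X Y f"
  shows "continuous_map (k_coreflection X) Y f"
  using assms by (auto simp: continuous_map_def openin_k_coreflection openin_imp_k_open)

lemma is_k_spaceI:
  assumes "\<And>U. k_open X U \<Longrightarrow> openin X U"
  shows "is_k_space X"
  using assms openin_imp_k_open unfolding is_k_space_def by blast

text \<open>A test map into \<open>X\<close> need not land in \<open>U\<close>. By regularity of the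
  compact Hausdorff test space, each point sent into \<open>V\<close> has a closed neighbourhood
  mapped into \<open>U\<close>; this neighbourhood is itself compact Hausdorff and tests
  \<open>V\<close>.\<close>

lemma is_k_space_open_subtopology:
  assumes X: "is_k_space X" and U: "openin X U"
  shows "is_k_space (subtopology X U)"
proof (rule is_k_spaceI)
  fix V assume V: "k_open (subtopology X U) V"
  then have sub: "V \<subseteq> U" "V \<subseteq> topspace X"
    by (auto simp: k_open_def)
  have "k_open X V"
    unfolding k_open_def
  proof (intro conjI allI impI)
    fix C :: "'a set list set set topology" and f
    assume C: "compact_space C \<and> Hausdorff_space C \<and> continuous_map C X f"
    let ?W = "{z \<in> topspace C. f z \<in> V}" and ?O = "{z \<in> topspace C. f z \<in> U}"
    have O: "openin C ?O"
      using C U openin_continuous_map_preimage by blast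
    show "openin C ?W"
    proof (subst openin_subopen, intro ballI)
      fix c assume c: "c \<in> ?W"
      have "neighbourhood_base_of (closedin C) C"
        using C compact_Hausdorff_imp_regular_space neighbourhood_base_of_closedin by blast
      moreover have "c \<in> ?O"
        using c sub by blast
      ultimately obtain B K where B: "openin C B" "closedin C K" "c \<in> B" "B \<subseteq> K" "K \<subseteq> ?O"
        using O unfolding neighbourhood_base_of by meson
      let ?K = "subtopology C K"
      have tK: "topspace ?K = K"
        by (rule topspace_subtopology_subset[OF closedin_subset[OF B(2)]])
      have "openin ?K {z \<in> topspace ?K. f z \<in> V}"
      proof (rule k_open_preimage[OF V])
        show "compact_space ?K" "Hausdorff_space ?K"
          using C B(2) by (auto intro: closedin_compact_space compact_space_subtopology Hausdorff_space_subtopology)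
        show "continuous_map ?K (subtopology X U) f"
          using C B(5) by (auto simp: continuous_map_in_subtopology continuous_map_from_subtopology)
      qed
      then obtain T where T: "openin C T" "{z \<in> K. f z \<in> V} = T \<inter> K"
        unfolding tK openin_subtopology by blast
      have "openin C (T \<inter> B)"
        using T(1) B(1) by (rule openin_Int)
      moreover have "c \<in> T \<inter> B"
        using T(2) B c by blast
      moreover have "T \<inter> B \<subseteq> ?W"
        using T(2) B openin_subset[OF B(1)] by blast
      ultimately show "\<exists>T. openin C T \<and> c \<in> T \<and> T \<subseteq> ?W"
        by blast
    qed
  qed (fact sub)
  then have "openin X V"
    using X by (simp add: is_k_space_def)
  then show "openin (subtopology X U) V"
    using sub by (simp add: openin_open_subtopology[OF U])
qed

text \<open>Makes the cylinder over a k-space a k-space, so that homotopies into k-products can be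
  checked by components. Around a point of a \<open>k_open\<close> set an open box is found,
  starting from a compact neighbourhood in \<open>Z\<close>.\<close>

lemma is_k_space_prod_compact_Hausdorff:
  fixes Z :: "'z topology" and X :: "'a topology"
  assumes Z: "compact_space Z" "Hausdorff_space Z" and X: "is_k_space X"
  shows "is_k_space (prod_topology Z X)"
proof (rule is_k_spaceI)
  fix W assume W: "k_open (prod_topology Z X) W"
  then have sub: "W \<subseteq> topspace Z \<times> topspace X"
    by (simp add: k_open_def)
  show "openin (prod_topology Z X) W"
  proof (subst openin_subopen, intro ballI)
    fix p assume p: "p \<in> W"
    then obtain t x where tx: "p = (t, x)" "t \<in> topspace Z" "x \<in> topspace X"
      using sub by blast
    have "openin Z {z \<in> topspace Z. (z, x) \<in> W}"
      using k_open_preimage[OF W Z, of "\<lambda>z. (z, x)"] tx by (simp add: continuous_map_paired)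
    then obtain B J where B: "openin Z B" "closedin Z J" "t \<in> B" "B \<subseteq> J"
      "J \<subseteq> {z \<in> topspace Z. (z, x) \<in> W}"
      using p tx Z compact_Hausdorff_imp_regular_space neighbourhood_base_of_closedin[of Z]
      unfolding neighbourhood_base_of by blast
    \<comment> \<open>As \<open>J\<close> is compact, the tube lemma in \<open>J \<times> C\<close>
      shows that \<open>V\<close> passes every test by a compact Hausdorff space \<open>C\<close>,
      which makes it open.\<close>
    define V where "V = {y \<in> topspace X. J \<times> {y} \<subseteq> W}"
    have tJ: "topspace (subtopology Z J) = J"
      by (rule topspace_subtopology_subset[OF closedin_subset[OF B(2)]])
    have J: "compact_space (subtopology Z J)" "Hausdorff_space (subtopology Z J)"
      using Z B(2) by (auto intro: closedin_compact_space compact_space_subtopology Hausdorff_space_subtopology)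
    have "k_open X V"
      unfolding k_open_def
    proof (intro conjI allI impI)
      show "V \<subseteq> topspace X" by (auto simp: V_def)
      fix C :: "'a set list set set topology" and f
      assume C: "compact_space C \<and> Hausdorff_space C \<and> continuous_map C X f"
      let ?JC = "prod_topology (subtopology Z J) C"
      let ?O = "{w \<in> topspace ?JC. (fst w, f (snd w)) \<in> W}"
      have O: "openin ?JC ?O"
      proof (rule k_open_preimage[OF W])
        show "compact_space ?JC" "Hausdorff_space ?JC"
          using C J by (simp_all add: compact_space_prod_topology Hausdorff_space_prod_topology)
        show "continuous_map ?JC (prod_topology Z X) (\<lambda>w. (fst w, f (snd w)))"
          unfolding continuous_map_paired
          using C continuous_map_compose[OF continuous_map_snd, of C X f "subtopology Z J"]
            continuous_map_into_fulltopology[OF continuous_map_fst, of Z J C]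
          by (simp add: o_def)
      qed
      show "openin C {c \<in> topspace C. f c \<in> V}"
      proof (subst openin_subopen, intro ballI)
        fix c assume c: "c \<in> {c \<in> topspace C. f c \<in> V}"
        have "J \<times> {c} \<subseteq> ?O"
          using c tJ by (auto simp: V_def)
        moreover have "compactin (subtopology Z J) J"
          using J(1) tJ by (simp add: compact_space_def)
        ultimately obtain L M where LM: "openin (subtopology Z J) L" "openin C M" "J \<subseteq> L" "c \<in> M" "L \<times> M \<subseteq> ?O"
          using tube_lemma_left[OF O, of J c] c by blast
        have "M \<subseteq> {c \<in> topspace C. f c \<in> V}"
        proof
          fix d assume d: "d \<in> M"
          have "d \<in> topspace C"
            using LM(2) d openin_subset by blast
          moreover have "f d \<in> topspace X"
            using C calculation continuous_map_image_subset_topspace by blast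
          moreover have "(z, d) \<in> ?O" if "z \<in> J" for z
            using LM d that by blast
          ultimately show "d \<in> {c \<in> topspace C. f c \<in> V}"
            by (auto simp: V_def)
        qed
        then show "\<exists>T. openin C T \<and> c \<in> T \<and> T \<subseteq> {c \<in> topspace C. f c \<in> V}"
          using LM by blast
      qed
    qed
    then have "openin X V"
      using X by (simp add: is_k_space_def)
    then have "openin (prod_topology Z X) (B \<times> V)"
      using B(1) by (simp add: openin_prod_Times_iff)
    moreover have "p \<in> B \<times> V" "B \<times> V \<subseteq> W"
      using tx B by (auto simp: V_def)
    ultimately show "\<exists>T. openin (prod_topology Z X) T \<and> p \<in> T \<and> T \<subseteq> W"
      by blast
  qed
qed

lemma topspace_k_prod_power [simp]:
  "topspace (k_prod_topology P (k_product_topology X I)) = topspace P \<times> (\<Pi>\<^sub>E i\<in>I. topspace (X i))"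
  by (simp add: k_prod_topology_def k_product_topology_def)

lemma continuous_map_k_prod_fst: "continuous_map (k_prod_topology X Y) X fst"
  unfolding k_prod_topology_def by (intro continuous_map_from_k_coreflection continuous_map_fst)

lemma continuous_map_k_prod_coordinate:
  assumes "i \<in> I"
  shows "continuous_map (k_prod_topology P (k_product_topology X I)) (X i) (\<lambda>z. snd z i)"
proof -
  have "continuous_map (k_product_topology X I) (X i) (\<lambda>x. x i)"
    unfolding k_product_topology_def
    using assms by (intro continuous_map_from_k_coreflection continuous_map_product_projection)
  moreover have "continuous_map (k_prod_topology P (k_product_topology X I)) (k_product_topology X I) snd"
    unfolding k_prod_topology_def by (intro continuous_map_from_k_coreflection continuous_map_snd)
  ultimately have "continuous_map (k_prod_topology P (k_product_topology X I)) (X i) ((\<lambda>x. x i) \<circ> snd)"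
    using continuous_map_compose by blast
  then show ?thesis
    by (simp add: o_def)
qed

text \<open>As \<open>D\<close> is a k-space, a map from \<open>D\<close> into a k-product is
  continuous as soon as it is continuous into the ordinary product, that is, in each component.
  Points of the power are extensional functions, hence \<open>ext\<close>.\<close>

lemma continuous_map_into_k_prod_power:
  assumes D: "is_k_space D" and f: "continuous_map D P f"
    and g: "\<And>i. i \<in> I \<Longrightarrow> continuous_map D (X i) (\<lambda>d. g d i)"
    and ext: "\<And>d. d \<in> topspace D \<Longrightarrow> g d \<in> extensional I"
  shows "continuous_map D (k_prod_topology P (k_product_topology X I)) (\<lambda>d. (f d, g d))"
proof -
  have "continuous_map D (product_topology X I) g"
    using g ext by (auto simp: continuous_map_componentwise)
  then have "continuous_map D (k_product_topology X I) g"
    by (simp add: k_product_topology_def continuous_map_into_k_coreflection[OF D])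
  with f show ?thesis
    by (simp add: k_prod_topology_def continuous_map_into_k_coreflection[OF D] continuous_map_paired)
qed


section \<open>Weights on powers of a space\<close>

lemma PiE_compose_permutes:
  assumes "x \<in> (\<Pi>\<^sub>E i\<in>{..<n::nat}. B)" "\<sigma> permutes {..<n}"
  shows "x \<circ> \<sigma> \<in> (\<Pi>\<^sub>E i\<in>{..<n}. B)"
proof (rule PiE_I)
  fix i assume "i \<in> {..<n}"
  then show "(x \<circ> \<sigma>) i \<in> B"
    using PiE_mem[OF assms(1), of "\<sigma> i"] permutes_in_image[OF assms(2), of i] by simp
next
  fix i assume "i \<notin> {..<n}"
  then show "(x \<circ> \<sigma>) i = undefined"
    using PiE_arb[OF assms(1)] permutes_not_in[OF assms(2)] by simp
qed

text \<open>All contractions \<open>h a\<close> end at the same point \<open>x0\<close>, and each is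
  used only where \<open>f a\<close> is positive. If \<open>X\<close> is nonempty, some
  \<open>f a\<close> is positive somewhere, and then \<open>h_1\<close> and
  \<open>h_continuous\<close> put \<open>x0\<close> in \<open>X\<close>; for empty \<open>X\<close>
  it is arbitrary.\<close>

locale contracting_partition =
  fixes X :: "'x topology" and A :: "'a set" and f :: "'a \<Rightarrow> 'x \<Rightarrow> real"
    and h :: "'a \<Rightarrow> real \<times> 'x \<Rightarrow> 'x" and x0 :: 'x
  assumes f_continuous: "a \<in> A \<Longrightarrow> continuous_map X euclideanreal (f a)"
    and f_nonneg: "\<lbrakk>a \<in> A; x \<in> topspace X\<rbrakk> \<Longrightarrow> 0 \<le> f a x"
    and f_sum: "x \<in> topspace X \<Longrightarrow> (\<Sum>a | a \<in> A \<and> f a x \<noteq> 0. f a x) = 1"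
    and f_locally_finite: "locally_finite_supports X A f"
    and h_continuous: "a \<in> A \<Longrightarrow> continuous_map
        (prod_topology (top_of_set {0..1}) (subtopology X {x \<in> topspace X. 0 < f a x})) X (h a)"
    and h_0: "\<lbrakk>a \<in> A; x \<in> topspace X; 0 < f a x\<rbrakk> \<Longrightarrow> h a (0, x) = x"
    and h_1: "\<lbrakk>a \<in> A; x \<in> topspace X; 0 < f a x\<rbrakk> \<Longrightarrow> h a (1, x) = x0"
begin

text \<open>Finite label sets keep the sums and products below finite; nonempty ones offer an index
  with which to contract each coordinate.\<close>

definition labellings :: "nat \<Rightarrow> (nat \<Rightarrow> 'a set) set" where
  "labellings n = (\<Pi>\<^sub>E i\<in>{..<n}. {B. finite B \<and> B \<noteq> {} \<and> B \<subseteq> A})"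

text \<open>
  As the \<open>f b\<close> sum to \<open>1\<close>, this finite expression is the sum of all values \<open>f b (x j)\<close> with
  \<open>b \<notin> \<tau> j\<close>.
\<close>

definition slack :: "nat \<Rightarrow> (nat \<Rightarrow> 'a set) \<Rightarrow> (nat \<Rightarrow> 'x) \<Rightarrow> real" where
  "slack n \<tau> x = (\<Sum>j<n. 1 - (\<Sum>b\<in>\<tau> j. f b (x j)))"

text \<open>For a labelling, the positive parts give a continuous function that is positive exactly
  on the set \<open>W\<^sub>\<tau>\<close>. For \<open>n = 0\<close> the empty product is
  \<open>1\<close>.\<close>

definition weight :: "nat \<Rightarrow> (nat \<Rightarrow> 'a set) \<Rightarrow> (nat \<Rightarrow> 'x) \<Rightarrow> real" where
  "weight n \<tau> x = (\<Prod>i<n. \<Prod>a\<in>\<tau> i. max 0 (f a (x i) - slack n \<tau> x))"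

text \<open>Summing over the group makes the weight invariant, so that it descends to orbits; it is
  positive exactly on the union of the translates of \<open>W\<^sub>\<tau>\<close>.\<close>

definition sym_weight :: "nat \<Rightarrow> (nat \<Rightarrow> 'a set) \<Rightarrow> (nat \<Rightarrow> 'x) \<Rightarrow> real" where
  "sym_weight n \<tau> x = (\<Sum>\<sigma> | \<sigma> permutes {..<n}. weight n \<tau> (x \<circ> \<sigma>))"

abbreviation power :: "nat \<Rightarrow> (nat \<Rightarrow> 'x) set" where
  "power n \<equiv> \<Pi>\<^sub>E i\<in>{..<n}. topspace X"

lemma labellingsD:
  assumes "\<tau> \<in> labellings n" "i < n"
  shows "finite (\<tau> i)" "\<tau> i \<noteq> {}" "\<tau> i \<subseteq> A"
  using assms by (auto simp: labellings_def dest: PiE_mem)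

lemma sum_le_1:
  assumes "finite B" "B \<subseteq> A" "x \<in> topspace X"
  shows "(\<Sum>b\<in>B. f b x) \<le> 1"
proof -
  have "(\<Sum>b\<in>B. f b x) = (\<Sum>b | b \<in> B \<and> f b x \<noteq> 0. f b x)"
    using assms(1) by (intro sum.mono_neutral_right) auto
  also have "\<dots> \<le> (\<Sum>a | a \<in> A \<and> f a x \<noteq> 0. f a x)"
    using assms locally_finite_supports_finite[OF f_locally_finite assms(3)] f_nonneg
    by (intro sum_mono2) auto
  finally show ?thesis
    by (simp add: f_sum assms)
qed

lemma defect_nonneg:
  assumes "\<tau> \<in> labellings n" "x \<in> power n" "j < n"
  shows "0 \<le> 1 - (\<Sum>b\<in>\<tau> j. f b (x j))"
  using sum_le_1[of "\<tau> j" "x j"] labellingsD[OF assms(1,3)] PiE_mem[OF assms(2)] assms(3) by simp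

lemma slack_nonneg:
  assumes "\<tau> \<in> labellings n" "x \<in> power n"
  shows "0 \<le> slack n \<tau> x"
  unfolding slack_def using defect_nonneg[OF assms] by (intro sum_nonneg) blast

text \<open>Adding \<open>a\<close> to \<open>\<tau> j\<close> leaves the sum of the values at
  \<open>x j\<close> at most \<open>1\<close>, so the summand of the slack at \<open>j\<close> is at
  least \<open>f a (x j)\<close>, and the other summands are nonnegative.\<close>

lemma le_slack:
  assumes "\<tau> \<in> labellings n" "x \<in> power n" "j < n" "a \<in> A" "a \<notin> \<tau> j"
  shows "f a (x j) \<le> slack n \<tau> x"
proof -
  have "(\<Sum>b\<in>insert a (\<tau> j). f b (x j)) \<le> 1"
    using labellingsD[OF assms(1,3)] assms by (intro sum_le_1) (auto simp: PiE_mem)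
  then have "f a (x j) \<le> 1 - (\<Sum>b\<in>\<tau> j. f b (x j))"
    using labellingsD[OF assms(1,3)] assms by simp
  also have "\<dots> \<le> slack n \<tau> x"
    unfolding slack_def using defect_nonneg[OF assms(1,2)] assms(3)
    by (intro member_le_sum[where f = "\<lambda>j. 1 - (\<Sum>b\<in>\<tau> j. f b (x j))"]) auto
  finally show ?thesis .
qed

lemma weight_nonneg: "0 \<le> weight n \<tau> x"
  unfolding weight_def by (intro prod_nonneg) auto

lemma weight_pos_iff:
  assumes "\<tau> \<in> labellings n"
  shows "0 < weight n \<tau> x \<longleftrightarrow> (\<forall>i<n. \<forall>a\<in>\<tau> i. slack n \<tau> x < f a (x i))"
proof -
  have "0 < weight n \<tau> x \<longleftrightarrow> weight n \<tau> x \<noteq> 0"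
    using weight_nonneg[of n \<tau> x] by linarith
  also have "\<dots> \<longleftrightarrow> (\<forall>i<n. \<forall>a\<in>\<tau> i. max 0 (f a (x i) - slack n \<tau> x) \<noteq> 0)"
    unfolding weight_def using labellingsD(1)[OF assms] by auto
  also have "\<dots> \<longleftrightarrow> (\<forall>i<n. \<forall>a\<in>\<tau> i. slack n \<tau> x < f a (x i))"
  proof -
    have "max 0 y \<noteq> 0 \<longleftrightarrow> 0 < y" for y :: real by auto
    then show ?thesis by simp
  qed
  finally show ?thesis .
qed

lemma weight_pos_imp:
  assumes "\<tau> \<in> labellings n" "x \<in> power n" "0 < weight n \<tau> x" "i < n" "a \<in> \<tau> i"
  shows "0 < f a (x i)"
  using assms slack_nonneg[OF assms(1,2)] by (force simp: weight_pos_iff)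

lemma weight_compose:
  assumes "\<sigma> permutes {..<n}"
  shows "weight n (\<tau> \<circ> \<sigma>) (x \<circ> \<sigma>) = weight n \<tau> x"
proof -
  have s: "slack n (\<tau> \<circ> \<sigma>) (x \<circ> \<sigma>) = slack n \<tau> x"
    unfolding slack_def using sum.permute[OF assms, of "\<lambda>j. 1 - (\<Sum>b\<in>\<tau> j. f b (x j))"]
    by (simp add: o_def)
  show ?thesis
    unfolding weight_def s
    using prod.permute[OF assms, of "\<lambda>i. \<Prod>a\<in>\<tau> i. max 0 (f a (x i) - slack n \<tau> x)"]
    by (simp add: o_def)
qed

text \<open>
  Two relabellings of the same \<open>\<tau>\<close> have equally many pairs \<open>(i, a)\<close>, so if they differ each has
  a pair that the other lacks; both weights being positive, each of the two corresponding values
  of the functions \<open>f a\<close> would exceed the other.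
\<close>

lemma weight_pos_unique:
  assumes \<tau>: "\<tau> \<in> labellings n" and \<sigma>: "\<sigma> permutes {..<n}" and x: "x \<in> power n"
    and pos: "0 < weight n \<tau> x" "0 < weight n (\<tau> \<circ> \<sigma>) x"
  shows "\<tau> \<circ> \<sigma> = \<tau>"
proof -
  let ?\<tau> = "\<tau> \<circ> \<sigma>"
  have \<tau>': "?\<tau> \<in> labellings n"
    using PiE_compose_permutes \<tau> \<sigma> unfolding labellings_def by blast
  let ?T = "Sigma {..<n} \<tau>" and ?T' = "Sigma {..<n} ?\<tau>"
  have fin: "finite ?T" "finite ?T'"
    using labellingsD(1)[OF \<tau>] labellingsD(1)[OF \<tau>'] by auto
  have card: "card ?T' = card ?T"
    using sum.permute[OF \<sigma>, of "\<lambda>i. card (\<tau> i)"] labellingsD(1)[OF \<tau>] labellingsD(1)[OF \<tau>']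
    by (simp add: card_SigmaI o_def)
  \<comment> \<open>The slack of \<open>\<rho>\<close> lies strictly below every value at a pair of
    \<open>\<rho>\<close> and bounds every value at a pair outside it.\<close>
  have cross: "f b (x j) < f a (x i)"
    if "\<rho> \<in> labellings n" "0 < weight n \<rho> x" "(i, a) \<in> Sigma {..<n} \<rho>" "(j, b) \<notin> Sigma {..<n} \<rho>"
      "j < n" "b \<in> A" for \<rho> i j a b
    using that le_slack[OF that(1) x, of j b] weight_pos_iff[OF that(1), of x] by fastforce
  have "?T' = ?T"
  proof (rule ccontr)
    assume ne: "?T' \<noteq> ?T"
    have "\<not> ?T \<subseteq> ?T'" "\<not> ?T' \<subseteq> ?T"
      using ne card_subset_eq[OF fin(2)] card_subset_eq[OF fin(1)] card by metis+
    then obtain i a j b where "(i, a) \<in> ?T" "(i, a) \<notin> ?T'" "(j, b) \<in> ?T'" "(j, b) \<notin> ?T"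
      by (meson subrelI)
    moreover from this have "i < n" "a \<in> A" "j < n" "b \<in> A"
      using labellingsD(3)[OF \<tau>] labellingsD(3)[OF \<tau>'] by auto
    ultimately have "f b (x j) < f a (x i)" "f a (x i) < f b (x j)"
      using cross[OF \<tau> pos(1)] cross[OF \<tau>' pos(2)] by blast+
    then show False by simp
  qed
  have "?\<tau> i = \<tau> i" if "i \<in> {..<n}" for i
  proof -
    have "(i, a) \<in> ?T' \<longleftrightarrow> (i, a) \<in> ?T" for a
      using \<open>?T' = ?T\<close> by simp
    then show ?thesis
      using that by auto
  qed
  then show ?thesis
    by (rule PiE_ext[OF \<tau>'[unfolded labellings_def] \<tau>[unfolded labellings_def]])
qed

lemma weight_pos_ex:
  assumes x: "x \<in> power n"
  shows "\<exists>\<tau>\<in>labellings n. 0 < weight n \<tau> x"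
proof
  \<comment> \<open>Labelling each coordinate with all indices that do not vanish there makes the
    slack zero, while all the labelled values are positive.\<close>
  define \<tau> where "\<tau> = (\<lambda>i\<in>{..<n}. {a. a \<in> A \<and> f a (x i) \<noteq> 0})"
  have xi: "x i \<in> topspace X" if "i < n" for i
    using that PiE_mem[OF x] by simp
  have "\<tau> i \<noteq> {}" if "i < n" for i
  proof
    assume "\<tau> i = {}"
    then have "(\<Sum>a | a \<in> A \<and> f a (x i) \<noteq> 0. f a (x i)) = 0"
      using that by (simp add: \<tau>_def)
    then show False
      using f_sum[OF xi[OF that]] by simp
  qed
  then show \<tau>: "\<tau> \<in> labellings n"
    using locally_finite_supports_finite[OF f_locally_finite xi]
    unfolding labellings_def by (auto simp: \<tau>_def)
  have "slack n \<tau> x = 0"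
    unfolding slack_def using f_sum[OF xi] by (simp add: \<tau>_def)
  moreover have "0 < f a (x i)" if "i < n" "a \<in> \<tau> i" for i a
    using that f_nonneg[OF _ xi, of a i] by (force simp: \<tau>_def)
  ultimately show "0 < weight n \<tau> x"
    by (simp add: weight_pos_iff[OF \<tau>])
qed

lemma sym_weight_nonneg: "0 \<le> sym_weight n \<tau> x"
  unfolding sym_weight_def by (intro sum_nonneg weight_nonneg)

lemma sym_weight_compose:
  assumes "\<sigma> permutes {..<n}"
  shows "sym_weight n \<tau> (x \<circ> \<sigma>) = sym_weight n \<tau> x"
  unfolding sym_weight_def
  using setum_permutations_compose_left[OF assms, of "\<lambda>\<rho>. weight n \<tau> (x \<circ> \<rho>)"]
  by (simp add: o_assoc)

text \<open>A sum of nonnegative terms is positive as soon as one term is, and permuting the point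
  by \<open>inv \<sigma>\<close> changes the weight in the same way as permuting the labelling by
  \<open>\<sigma>\<close>.\<close>

lemma sym_weight_pos_iff:
  "0 < sym_weight n \<tau> x \<longleftrightarrow> (\<exists>\<sigma>. \<sigma> permutes {..<n} \<and> 0 < weight n (\<tau> \<circ> \<sigma>) x)"
proof -
  have eq: "weight n \<tau> (x \<circ> inv \<sigma>) = weight n (\<tau> \<circ> \<sigma>) x" if "\<sigma> permutes {..<n}" for \<sigma>
    using weight_compose[OF that, of \<tau> "x \<circ> inv \<sigma>"] that
    by (simp add: permutes_inv_o o_assoc[symmetric])
  have "0 < sym_weight n \<tau> x \<longleftrightarrow> sym_weight n \<tau> x \<noteq> 0"
    using sym_weight_nonneg[of n \<tau> x] by linarith
  also have "\<dots> \<longleftrightarrow> (\<exists>\<sigma>. \<sigma> permutes {..<n} \<and> weight n \<tau> (x \<circ> \<sigma>) \<noteq> 0)"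
    unfolding sym_weight_def
    by (subst sum_nonneg_eq_0_iff) (auto simp: finite_permutations weight_nonneg)
  also have "\<dots> \<longleftrightarrow> (\<exists>\<sigma>. \<sigma> permutes {..<n} \<and> 0 < weight n \<tau> (x \<circ> \<sigma>))"
    using weight_nonneg by (metis less_le)
  also have "\<dots> \<longleftrightarrow> (\<exists>\<sigma>. \<sigma> permutes {..<n} \<and> 0 < weight n (\<tau> \<circ> \<sigma>) x)"
    using eq permutes_inv permutes_inv_inv by metis
  finally show ?thesis .
qed

section \<open>Equivariant selection of a labelling\<close>

lemma labellings_compose:
  assumes "\<tau> \<in> labellings n" "\<sigma> permutes {..<n}"
  shows "\<tau> \<circ> \<sigma> \<in> labellings n"
  using assms PiE_compose_permutes unfolding labellings_def by blast

text \<open>The labelling is selected and not the permutation, because different permutations give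
  the same translate when labels repeat. For a labelling \<open>\<tau>\<close>,
  \<open>weight_pos_unique\<close> makes the description definite at the points of the power with
  positive symmetrized weight.\<close>

definition selected :: "nat \<Rightarrow> (nat \<Rightarrow> 'a set) \<Rightarrow> (nat \<Rightarrow> 'x) \<Rightarrow> nat \<Rightarrow> 'a set" where
  "selected n \<tau> x = (THE \<rho>. (\<exists>\<sigma>. \<sigma> permutes {..<n} \<and> \<rho> = \<tau> \<circ> \<sigma>) \<and> 0 < weight n \<rho> x)"

lemma selected_eq:
  assumes \<tau>: "\<tau> \<in> labellings n" and x: "x \<in> power n" and \<sigma>: "\<sigma> permutes {..<n}"
    and pos: "0 < weight n (\<tau> \<circ> \<sigma>) x"
  shows "selected n \<tau> x = \<tau> \<circ> \<sigma>"
  unfolding selected_def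
proof (rule the_equality)
  show "(\<exists>\<sigma>'. \<sigma>' permutes {..<n} \<and> \<tau> \<circ> \<sigma> = \<tau> \<circ> \<sigma>') \<and> 0 < weight n (\<tau> \<circ> \<sigma>) x"
    using \<sigma> pos by blast
  fix \<rho> assume "(\<exists>\<sigma>'. \<sigma>' permutes {..<n} \<and> \<rho> = \<tau> \<circ> \<sigma>') \<and> 0 < weight n \<rho> x"
  then obtain \<sigma>' where \<sigma>': "\<sigma>' permutes {..<n}" "\<rho> = \<tau> \<circ> \<sigma>'" "0 < weight n \<rho> x"
    by blast
  \<comment> \<open>The competitor is written as a relabelling of
    \<open>\<tau> \<circ> \<sigma>\<close>, the form that \<open>weight_pos_unique\<close>
    compares.\<close>
  have "\<rho> = (\<tau> \<circ> \<sigma>) \<circ> (inv \<sigma> \<circ> \<sigma>')"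
    using \<sigma>' \<sigma> by (simp add: o_assoc[symmetric]) (simp add: o_assoc permutes_inv_o)
  then show "\<rho> = \<tau> \<circ> \<sigma>"
    using weight_pos_unique[OF labellings_compose[OF \<tau> \<sigma>] permutes_compose[OF \<sigma>'(1) permutes_inv[OF \<sigma>]] x pos] \<sigma>'(3)
    by simp
qed

text \<open>If \<open>\<tau> \<circ> \<rho>\<close> has positive weight at \<open>x\<close>, then
  \<open>\<tau> \<circ> \<rho> \<circ> \<sigma>\<close> has the same weight at
  \<open>x \<circ> \<sigma>\<close>. This equivariance lets the deformation descend to
  orbits.\<close>

lemma selected_compose:
  assumes \<tau>: "\<tau> \<in> labellings n" and x: "x \<in> power n" and \<sigma>: "\<sigma> permutes {..<n}"
    and pos: "0 < sym_weight n \<tau> x"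
  shows "selected n \<tau> (x \<circ> \<sigma>) = selected n \<tau> x \<circ> \<sigma>"
proof -
  obtain \<rho> where \<rho>: "\<rho> permutes {..<n}" "0 < weight n (\<tau> \<circ> \<rho>) x"
    using pos by (auto simp: sym_weight_pos_iff)
  then have "0 < weight n (\<tau> \<circ> (\<rho> \<circ> \<sigma>)) (x \<circ> \<sigma>)"
    using weight_compose[OF \<sigma>] by (simp add: o_assoc)
  then show ?thesis
    using selected_eq[OF \<tau> x \<rho>] permutes_compose[OF \<sigma> \<rho>(1)]
      selected_eq[OF \<tau> PiE_compose_permutes[OF x \<sigma>]] by (simp add: o_assoc)
qed

end


section \<open>Orbit spaces\<close>

text \<open>The induced map is given by an explicit term, \<open>g\<close> at a chosen preimage, so
  that maps on orbit spaces can be defined outright; \<open>compat\<close> makes the value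
  independent of the choice.\<close>

lemma continuous_map_inv_into_quotient:
  assumes q: "quotient_map E Y q" and g: "continuous_map E Z g"
    and compat: "\<And>x y. \<lbrakk>x \<in> topspace E; y \<in> topspace E; q x = q y\<rbrakk> \<Longrightarrow> g x = g y"
  shows "continuous_map Y Z (g \<circ> inv_into (topspace E) q)"
    and "\<And>x. x \<in> topspace E \<Longrightarrow> (g \<circ> inv_into (topspace E) q) (q x) = g x"
proof -
  show eq: "(g \<circ> inv_into (topspace E) q) (q x) = g x" if "x \<in> topspace E" for x
    unfolding o_def by (rule compat) (use that in \<open>auto simp: inv_into_into f_inv_into_f\<close>)
  have "continuous_map E Z ((g \<circ> inv_into (topspace E) q) \<circ> q)"
    by (rule continuous_map_eq[OF g]) (use eq in simp)
  then show "continuous_map Y Z (g \<circ> inv_into (topspace E) q)"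
    by (rule continuous_compose_quotient_map[OF q])
qed

text \<open>The number \<open>n\<close> of inputs is fixed. For \<open>n = 0\<close> the power is a
  single point even if \<open>X\<close> is empty, so \<open>x0\<close> is required to lie in
  \<open>X\<close> only for positive \<open>n\<close>.\<close>

locale operad_partition =
  topological_operad P act unit compo + contracting_partition X A f h x0
  for P :: "nat \<Rightarrow> 'p topology" and act unit compo
    and X :: "'x topology" and A :: "'a set" and f h x0 +
  fixes n :: nat
  assumes x0_in: "0 < n \<Longrightarrow> x0 \<in> topspace X"
begin

abbreviation E :: "('p \<times> (nat \<Rightarrow> 'x)) topology" where
  "E \<equiv> k_prod_topology (P n) (k_product_topology (\<lambda>_. X) {..<n})"

abbreviation (input) perms :: "(nat \<Rightarrow> nat) set" where
  "perms \<equiv> {\<sigma>. \<sigma> permutes {..<n}}"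

definition translate :: "(nat \<Rightarrow> nat) \<Rightarrow> 'p \<times> (nat \<Rightarrow> 'x) \<Rightarrow> 'p \<times> (nat \<Rightarrow> 'x)" where
  "translate \<sigma> z = (act n (fst z) \<sigma>, snd z \<circ> \<sigma>)"

definition orb :: "'p \<times> (nat \<Rightarrow> 'x) \<Rightarrow> ('p \<times> (nat \<Rightarrow> 'x)) set" where
  "orb z = {translate \<sigma> z | \<sigma>. \<sigma> permutes {..<n}}"

definition base_orb :: "'p \<Rightarrow> 'p set" where
  "base_orb p = {act n p \<sigma> | \<sigma>. \<sigma> permutes {..<n}}"

abbreviation Y where "Y \<equiv> balanced_power P act X n"
abbreviation B where "B \<equiv> sym_orbit_space P act n"

lemma Y_eq: "Y = quotient_topology E orb"
proof -
  have "orb = (\<lambda>(p, x). {(act n p \<sigma>, x \<circ> \<sigma>) | \<sigma>. \<sigma> permutes {..<n}})"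
    by (auto simp: fun_eq_iff orb_def translate_def)
  then show ?thesis
    by (simp add: balanced_power_def)
qed

lemma quotient_orb: "quotient_map E Y orb"
  unfolding Y_eq by (rule quotient_map_quotient_topology)

lemma quotient_base_orb: "quotient_map (P n) B base_orb"
  unfolding sym_orbit_space_def base_orb_def[abs_def] by (rule quotient_map_quotient_topology)

lemma is_k_space_E: "is_k_space E"
  by (simp add: k_prod_topology_def is_k_space_k_coreflection)

lemma act_in: "p \<in> topspace (P n) \<Longrightarrow> \<sigma> permutes {..<n} \<Longrightarrow> act n p \<sigma> \<in> topspace (P n)"
  using act_continuous continuous_map_image_subset_topspace by blast

lemma E_D:
  assumes "z \<in> topspace E"
  shows "fst z \<in> topspace (P n)" "snd z \<in> power n" "i < n \<Longrightarrow> snd z i \<in> topspace X"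
proof -
  show "fst z \<in> topspace (P n)" and z: "snd z \<in> power n"
    using assms by (simp_all only: topspace_k_prod_power mem_Times_iff)
  show "i < n \<Longrightarrow> snd z i \<in> topspace X"
    using PiE_mem[OF z] by simp
qed

lemma translate_id: "z \<in> topspace E \<Longrightarrow> translate id z = z"
  using act_id E_D(1) by (simp add: translate_def)

lemma translate_translate:
  assumes "z \<in> topspace E" "\<sigma> permutes {..<n}" "\<tau> permutes {..<n}"
  shows "translate \<tau> (translate \<sigma> z) = translate (\<sigma> \<circ> \<tau>) z"
  using act_comp[OF E_D(1)[OF assms(1)] assms(2,3)] by (simp add: translate_def o_assoc)

lemma translate_continuous:
  assumes "\<sigma> permutes {..<n}"
  shows "continuous_map E E (translate \<sigma>)"
  unfolding translate_def[abs_def]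
proof (rule continuous_map_into_k_prod_power[OF is_k_space_E])
  show "continuous_map E (P n) (\<lambda>z. act n (fst z) \<sigma>)"
    using continuous_map_compose[OF continuous_map_k_prod_fst act_continuous[OF assms]]
    by (simp add: o_def)
  show "continuous_map E X (\<lambda>z. (snd z \<circ> \<sigma>) i)" if "i \<in> {..<n}" for i
    using that continuous_map_k_prod_coordinate[of "\<sigma> i" "{..<n}" "P n" "\<lambda>_. X"]
      permutes_in_image[OF assms, of i] by simp
  show "snd z \<circ> \<sigma> \<in> extensional {..<n}" if "z \<in> topspace E" for z
    using PiE_compose_permutes[OF E_D(2)[OF that] assms] by (simp add: PiE_def)
qed

lemma orb_translate:
  assumes z: "z \<in> topspace E" and \<sigma>: "\<sigma> permutes {..<n}"
  shows "orb (translate \<sigma> z) = orb z"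
proof
  show "orb (translate \<sigma> z) \<subseteq> orb z"
  proof
    fix w assume "w \<in> orb (translate \<sigma> z)"
    then obtain \<tau> where \<tau>: "\<tau> permutes {..<n}" "w = translate \<tau> (translate \<sigma> z)"
      by (auto simp: orb_def)
    then have "w = translate (\<sigma> \<circ> \<tau>) z" "\<sigma> \<circ> \<tau> permutes {..<n}"
      using translate_translate[OF z \<sigma>] permutes_compose[OF _ \<sigma>] by simp_all
    then show "w \<in> orb z"
      unfolding orb_def by blast
  qed
  show "orb z \<subseteq> orb (translate \<sigma> z)"
  proof
    fix w assume "w \<in> orb z"
    then obtain \<tau> where \<tau>: "\<tau> permutes {..<n}" "w = translate \<tau> z"
      by (auto simp: orb_def)
    have "inv \<sigma> \<circ> \<tau> permutes {..<n}"
      by (intro permutes_compose \<tau> permutes_inv \<sigma>)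
    moreover from this have "w = translate (inv \<sigma> \<circ> \<tau>) (translate \<sigma> z)"
      using translate_translate[OF z \<sigma>] \<tau> permutes_inv_o(1)[OF \<sigma>] by (simp add: o_assoc)
    ultimately show "w \<in> orb (translate \<sigma> z)"
      by (auto simp: orb_def)
  qed
qed

lemma orb_eqD:
  assumes "z' \<in> topspace E" "orb z = orb z'"
  obtains \<sigma> where "\<sigma> permutes {..<n}" "z' = translate \<sigma> z"
proof -
  have "z' \<in> orb z'"
    unfolding orb_def using translate_id[OF assms(1)]
    by (intro CollectI exI[of _ id]) (simp add: permutes_id)
  then show ?thesis
    using that assms(2) by (auto simp: orb_def)
qed

lemma base_orb_act:
  assumes p: "p \<in> topspace (P n)" and \<sigma>: "\<sigma> permutes {..<n}"
  shows "base_orb (act n p \<sigma>) = base_orb p"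
proof
  show "base_orb (act n p \<sigma>) \<subseteq> base_orb p"
  proof
    fix w assume "w \<in> base_orb (act n p \<sigma>)"
    then obtain \<tau> where \<tau>: "\<tau> permutes {..<n}" "w = act n (act n p \<sigma>) \<tau>"
      by (auto simp: base_orb_def)
    then have "w = act n p (\<sigma> \<circ> \<tau>)" "\<sigma> \<circ> \<tau> permutes {..<n}"
      using act_comp[OF p \<sigma>] permutes_compose[OF _ \<sigma>] by simp_all
    then show "w \<in> base_orb p"
      unfolding base_orb_def by blast
  qed
  show "base_orb p \<subseteq> base_orb (act n p \<sigma>)"
  proof
    fix w assume "w \<in> base_orb p"
    then obtain \<tau> where \<tau>: "\<tau> permutes {..<n}" "w = act n p \<tau>"
      by (auto simp: base_orb_def)
    have "inv \<sigma> \<circ> \<tau> permutes {..<n}"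
      by (intro permutes_compose \<tau> permutes_inv \<sigma>)
    moreover from this have "w = act n (act n p \<sigma>) (inv \<sigma> \<circ> \<tau>)"
      using act_comp[OF p \<sigma>, of "inv \<sigma> \<circ> \<tau>"] \<tau> permutes_inv_o(1)[OF \<sigma>]
      by (simp add: o_assoc)
    ultimately show "w \<in> base_orb (act n p \<sigma>)"
      by (auto simp: base_orb_def)
  qed
qed

lemma base_orb_eqD:
  assumes "p' \<in> topspace (P n)" "base_orb p = base_orb p'"
  obtains \<sigma> where "\<sigma> permutes {..<n}" "p' = act n p \<sigma>"
proof -
  have "p' \<in> base_orb p'"
    unfolding base_orb_def using act_id[OF assms(1)]
    by (intro CollectI exI[of _ id]) (simp add: permutes_id)
  then show ?thesis
    using that assms(2) by (auto simp: base_orb_def)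
qed

text \<open>The saturation of an open set is the union of its preimages under all translations.
  Openness of \<open>orb\<close> turns neighbourhoods in \<open>E\<close> into neighbourhoods of
  orbits.\<close>

lemma open_map_orb: "open_map E Y orb"
  unfolding open_map_def
proof (intro allI impI)
  fix U assume U: "openin E U"
  then have sub: "U \<subseteq> topspace E"
    by (rule openin_subset)
  have eq: "{z \<in> topspace E. orb z \<in> orb ` U} = (\<Union>\<sigma>\<in>perms. {z \<in> topspace E. translate \<sigma> z \<in> U})"
  proof (intro equalityI subsetI)
    fix z assume z: "z \<in> {z \<in> topspace E. orb z \<in> orb ` U}"
    then obtain u where u: "u \<in> U" "orb z = orb u" by blast
    then obtain \<sigma> where "\<sigma> permutes {..<n}" "u = translate \<sigma> z"
      using orb_eqD sub by blast
    with u z show "z \<in> (\<Union>\<sigma>\<in>perms. {z \<in> topspace E. translate \<sigma> z \<in> U})" by blast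
  next
    fix z assume "z \<in> (\<Union>\<sigma>\<in>perms. {z \<in> topspace E. translate \<sigma> z \<in> U})"
    then obtain \<sigma> where "\<sigma> permutes {..<n}" "z \<in> topspace E" "translate \<sigma> z \<in> U" by blast
    then show "z \<in> {z \<in> topspace E. orb z \<in> orb ` U}"
      using orb_translate[of z \<sigma>] by (metis (mono_tags, lifting) imageI mem_Collect_eq)
  qed
  have "openin E {z \<in> topspace E. orb z \<in> orb ` U}"
    unfolding eq
    by (intro openin_Union) (use translate_continuous U openin_continuous_map_preimage in blast)
  then show "openin Y (orb ` U)"
    using sub by (auto simp: Y_eq openin_quotient_topology)
qed

section \<open>Weights and the equivariant contraction on \<open>E\<close>\<close>

lemma continuous_map_weight:
  assumes "\<tau> \<in> labellings n"
  shows "continuous_map E euclideanreal (\<lambda>z. weight n \<tau> (snd z))"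
proof -
  have *: "continuous_map E euclideanreal (\<lambda>z. f a (snd z i))" if "i < n" "a \<in> \<tau> i" for i a
    using continuous_map_compose[OF continuous_map_k_prod_coordinate[of i "{..<n}" "P n" "\<lambda>_. X"] f_continuous[of a]]
      that labellingsD(3)[OF assms that(1)] by (auto simp: o_def)
  show ?thesis
    unfolding weight_def slack_def
    by (intro continuous_intros *) (use labellingsD(1)[OF assms] in auto)
qed

lemma continuous_map_sym_weight:
  assumes "\<tau> \<in> labellings n"
  shows "continuous_map E euclideanreal (\<lambda>z. sym_weight n \<tau> (snd z))"
  unfolding sym_weight_def
proof (intro continuous_map_sum)
  fix \<sigma> assume "\<sigma> \<in> {\<sigma>. \<sigma> permutes {..<n}}"
  then have \<sigma>: "\<sigma> permutes {..<n}" by simp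
  show "continuous_map E euclideanreal (\<lambda>z. weight n \<tau> (snd z \<circ> \<sigma>))"
    using continuous_map_compose[OF translate_continuous[OF \<sigma>] continuous_map_weight[OF assms]]
    by (simp add: o_def translate_def)
qed (simp add: finite_permutations)

text \<open>The operad coordinate stays fixed. \<open>SOME\<close> picks an index from the label set
  alone, so the index travels with its coordinate under permutations, as equivariance
  requires.\<close>

definition contraction :: "(nat \<Rightarrow> 'a set) \<Rightarrow> real \<times> ('p \<times> (nat \<Rightarrow> 'x)) \<Rightarrow> 'p \<times> (nat \<Rightarrow> 'x)" where
  "contraction \<tau> w = (fst (snd w),
     \<lambda>i\<in>{..<n}. h (SOME a. a \<in> selected n \<tau> (snd (snd w)) i) (fst w, snd (snd w) i))"

text \<open>On the open set \<open>T \<sigma>\<close> where \<open>\<tau> \<circ> \<sigma>\<close>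
  has positive weight the selected labelling is constant, so each coordinate is moved by a single
  \<open>h a\<close>. The sets \<open>T \<sigma>\<close> cover the domain and the pieces agree on
  overlaps.\<close>

lemma continuous_map_contraction:
  assumes \<tau>: "\<tau> \<in> labellings n" and V: "openin E V"
    and pos: "\<And>z. z \<in> V \<Longrightarrow> 0 < sym_weight n \<tau> (snd z)"
  shows "continuous_map (prod_topology (top_of_set {0..1}) (subtopology E V)) E (contraction \<tau>)"
proof -
  define D where "D = prod_topology (top_of_set {0..1::real}) (subtopology E V)"
  have VE: "V \<subseteq> topspace E"
    using V by (rule openin_subset)
  have tD: "topspace D = {0..1} \<times> V"
    using VE by (auto simp: D_def)
  \<comment> \<open>With a k-space as domain, continuity into \<open>E\<close> can be checked in
    each component.\<close>
  have kD: "is_k_space D"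
    unfolding D_def
    by (intro is_k_space_prod_compact_Hausdorff is_k_space_open_subtopology is_k_space_E V)
      (simp_all add: compact_space_subtopology Hausdorff_space_subtopology)
  have cfst: "continuous_map D (top_of_set {0..1}) fst"
    unfolding D_def by (rule continuous_map_fst)
  have csnd: "continuous_map D E snd"
    unfolding D_def by (rule continuous_map_into_fulltopology[OF continuous_map_snd])
  define T where "T \<sigma> = {w \<in> topspace D. weight n (\<tau> \<circ> \<sigma>) (snd (snd w)) \<in> {0<..}}" for \<sigma>
  define k where "k \<sigma> w = (fst (snd w),
     \<lambda>i\<in>{..<n}. h (SOME a. a \<in> (\<tau> \<circ> \<sigma>) i) (fst w, snd (snd w) i))"
    for \<sigma> and w :: "real \<times> ('p \<times> (nat \<Rightarrow> 'x))"
  have sel: "selected n \<tau> (snd (snd w)) = \<tau> \<circ> \<sigma>" if "w \<in> T \<sigma>" "\<sigma> permutes {..<n}" for w \<sigma>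
    using that selected_eq[OF \<tau> E_D(2) that(2), of "snd w"] VE by (auto simp: T_def tD)
  have eq: "contraction \<tau> w = k \<sigma> w" if "w \<in> T \<sigma>" "\<sigma> permutes {..<n}" for w \<sigma>
    by (simp add: contraction_def k_def sel[OF that])
  have "continuous_map D E (contraction \<tau>)"
  proof (rule pasting_lemma[where I = perms and T = T and f = k])
    fix \<sigma> assume "\<sigma> \<in> perms"
    then have \<sigma>: "\<sigma> permutes {..<n}" by simp
    have \<tau>\<sigma>: "\<tau> \<circ> \<sigma> \<in> labellings n"
      by (rule labellings_compose[OF \<tau> \<sigma>])
    show opT: "openin D (T \<sigma>)"
      unfolding T_def
      by (rule openin_continuous_map_preimage[where Y = euclideanreal])
        (use continuous_map_compose[OF csnd continuous_map_weight[OF \<tau>\<sigma>]] in \<open>auto simp: o_def\<close>)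
    let ?D = "subtopology D (T \<sigma>)"
    have tT: "topspace ?D = T \<sigma>"
      using openin_subset[OF opT] by (rule topspace_subtopology_subset)
    show "continuous_map ?D E (k \<sigma>)"
      unfolding k_def[abs_def]
    proof (rule continuous_map_into_k_prod_power[OF is_k_space_open_subtopology[OF kD opT]])
      show "continuous_map ?D (P n) (\<lambda>w. fst (snd w))"
        using continuous_map_compose[OF csnd continuous_map_k_prod_fst]
        by (auto simp: o_def intro: continuous_map_from_subtopology)
      fix i assume "i \<in> {..<n}"
      then have i: "i < n" by simp
      define a where "a = (SOME a. a \<in> (\<tau> \<circ> \<sigma>) i)"
      have a: "a \<in> (\<tau> \<circ> \<sigma>) i"
        unfolding a_def using labellingsD(2)[OF \<tau>\<sigma> i] by (simp add: some_in_eq)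
      have aA: "a \<in> A"
        using a labellingsD(3)[OF \<tau>\<sigma> i] by blast
      have "continuous_map D X (\<lambda>w. snd (snd w) i)"
        using continuous_map_compose[OF csnd continuous_map_k_prod_coordinate[of i "{..<n}" "P n" "\<lambda>_. X"]] i
        by (auto simp: o_def)
      \<comment> \<open>Positive weight keeps the coordinate inside the domain of the contraction
        \<open>h a\<close>.\<close>
      moreover have "snd (snd w) i \<in> {x \<in> topspace X. 0 < f a x}" if "w \<in> T \<sigma>" for w
      proof -
        have w: "snd w \<in> topspace E" "0 < weight n (\<tau> \<circ> \<sigma>) (snd (snd w))"
          using that VE by (auto simp: T_def tD)
        show ?thesis
          using weight_pos_imp[OF \<tau>\<sigma> E_D(2)[OF w(1)] w(2) i a] E_D(3)[OF w(1) i] by simp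
      qed
      ultimately have "continuous_map ?D (subtopology X {x \<in> topspace X. 0 < f a x}) (\<lambda>w. snd (snd w) i)"
        unfolding continuous_map_in_subtopology tT by (auto intro: continuous_map_from_subtopology)
      moreover have "continuous_map ?D (top_of_set {0..1}) fst"
        using cfst by (rule continuous_map_from_subtopology)
      ultimately have "continuous_map ?D (prod_topology (top_of_set {0..1}) (subtopology X {x \<in> topspace X. 0 < f a x}))
          (\<lambda>w. (fst w, snd (snd w) i))"
        by (simp add: continuous_map_paired)
      from continuous_map_compose[OF this h_continuous[OF aA]]
      have "continuous_map ?D X (\<lambda>w. h a (fst w, snd (snd w) i))"
        by (simp add: o_def)
      then show "continuous_map ?D X (\<lambda>w. (\<lambda>i\<in>{..<n}. h (SOME a. a \<in> (\<tau> \<circ> \<sigma>) i) (fst w, snd (snd w) i)) i)"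
        using i by (simp add: a_def)
    qed simp
  next
    fix \<sigma> \<rho> w assume "\<sigma> \<in> perms" "\<rho> \<in> perms" "w \<in> topspace D \<inter> T \<sigma> \<inter> T \<rho>"
    then show "k \<sigma> w = k \<rho> w"
      using eq[of w \<sigma>] eq[of w \<rho>] by simp
  next
    fix w assume w: "w \<in> topspace D"
    then have "0 < sym_weight n \<tau> (snd (snd w))"
      using pos by (auto simp: tD)
    then obtain \<sigma> where "\<sigma> permutes {..<n}" "0 < weight n (\<tau> \<circ> \<sigma>) (snd (snd w))"
      by (auto simp: sym_weight_pos_iff)
    then show "\<exists>j. j \<in> perms \<and> w \<in> T j \<and> contraction \<tau> w = k j w"
      using eq[of w \<sigma>] w by (auto simp: T_def)
  qed
  then show ?thesis
    by (simp add: D_def)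
qed

lemma contraction_in:
  assumes "\<tau> \<in> labellings n" "z \<in> topspace E" "0 < sym_weight n \<tau> (snd z)" "t \<in> {0..1}"
  shows "contraction \<tau> (t, z) \<in> topspace E"
proof -
  let ?V = "{z \<in> topspace E. sym_weight n \<tau> (snd z) \<in> {0<..}}"
  have "openin E ?V"
    by (rule openin_continuous_map_preimage[OF continuous_map_sym_weight[OF assms(1)]]) auto
  from continuous_map_contraction[OF assms(1) this]
  have "continuous_map (prod_topology (top_of_set {0..1}) (subtopology E ?V)) E (contraction \<tau>)"
    by simp
  from continuous_map_image_subset_topspace[OF this] show ?thesis
    using assms by auto
qed

lemma contraction_translate:
  assumes \<tau>: "\<tau> \<in> labellings n" and z: "z \<in> topspace E" and pos: "0 < sym_weight n \<tau> (snd z)"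
    and \<sigma>: "\<sigma> permutes {..<n}"
  shows "contraction \<tau> (t, translate \<sigma> z) = translate \<sigma> (contraction \<tau> (t, z))"
proof -
  have "(\<lambda>i\<in>{..<n}. h (SOME a. a \<in> selected n \<tau> (snd z \<circ> \<sigma>) i) (t, (snd z \<circ> \<sigma>) i)) =
      (\<lambda>i\<in>{..<n}. h (SOME a. a \<in> selected n \<tau> (snd z) i) (t, snd z i)) \<circ> \<sigma>"
    using permutes_in_image[OF \<sigma>]
    by (auto simp: fun_eq_iff selected_compose[OF \<tau> E_D(2)[OF z] \<sigma> pos] restrict_def)
  then show ?thesis
    by (simp add: contraction_def translate_def)
qed

lemma contraction_ends:
  assumes \<tau>: "\<tau> \<in> labellings n" and z: "z \<in> topspace E" and pos: "0 < sym_weight n \<tau> (snd z)"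
  shows "contraction \<tau> (0, z) = z" "contraction \<tau> (1, z) = (fst z, \<lambda>i\<in>{..<n}. x0)"
proof -
  obtain \<sigma> where \<sigma>: "\<sigma> permutes {..<n}" "0 < weight n (\<tau> \<circ> \<sigma>) (snd z)"
    using pos by (auto simp: sym_weight_pos_iff)
  have sel: "selected n \<tau> (snd z) = \<tau> \<circ> \<sigma>"
    by (rule selected_eq[OF \<tau> E_D(2)[OF z] \<sigma>])
  have \<tau>\<sigma>: "\<tau> \<circ> \<sigma> \<in> labellings n"
    by (rule labellings_compose[OF \<tau> \<sigma>(1)])
  have a: "(SOME a. a \<in> (\<tau> \<circ> \<sigma>) i) \<in> A" "0 < f (SOME a. a \<in> (\<tau> \<circ> \<sigma>) i) (snd z i)" if "i < n" for i
  proof -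
    have "(SOME a. a \<in> (\<tau> \<circ> \<sigma>) i) \<in> (\<tau> \<circ> \<sigma>) i"
      using labellingsD(2)[OF \<tau>\<sigma> that] by (simp only: some_in_eq) simp
    then show "(SOME a. a \<in> (\<tau> \<circ> \<sigma>) i) \<in> A" "0 < f (SOME a. a \<in> (\<tau> \<circ> \<sigma>) i) (snd z i)"
      using labellingsD(3)[OF \<tau>\<sigma> that] weight_pos_imp[OF \<tau>\<sigma> E_D(2)[OF z] \<sigma>(2) that] by blast+
  qed
  have "(\<lambda>i\<in>{..<n}. h (SOME a. a \<in> (\<tau> \<circ> \<sigma>) i) (0, snd z i)) = (\<lambda>i\<in>{..<n}. snd z i)"
    by (rule restrict_ext) (use h_0 a E_D(3)[OF z] in simp)
  also have "\<dots> = snd z"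
    using E_D(2)[OF z] by (rule PiE_restrict)
  finally show "contraction \<tau> (0, z) = z"
    by (simp add: contraction_def sel)
  have "(\<lambda>i\<in>{..<n}. h (SOME a. a \<in> (\<tau> \<circ> \<sigma>) i) (1, snd z i)) = (\<lambda>i\<in>{..<n}. x0)"
    by (rule restrict_ext) (use h_1 a E_D(3)[OF z] in simp)
  then show "contraction \<tau> (1, z) = (fst z, \<lambda>i\<in>{..<n}. x0)"
    by (simp add: contraction_def sel)
qed

section \<open>The projection \<open>[p, x] \<mapsto> [p]\<close> and its section\<close>

definition proj :: "('p \<times> (nat \<Rightarrow> 'x)) set \<Rightarrow> 'p set" where
  "proj = (base_orb \<circ> fst) \<circ> inv_into (topspace E) orb"

definition sect :: "'p set \<Rightarrow> ('p \<times> (nat \<Rightarrow> 'x)) set" where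
  "sect = (\<lambda>p. orb (p, \<lambda>i\<in>{..<n}. x0)) \<circ> inv_into (topspace (P n)) base_orb"

lemma proj: "continuous_map Y B proj" "z \<in> topspace E \<Longrightarrow> proj (orb z) = base_orb (fst z)"
proof -
  have c: "continuous_map E B (base_orb \<circ> fst)"
    by (rule continuous_map_compose[OF continuous_map_k_prod_fst quotient_imp_continuous_map[OF quotient_base_orb]])
  have compat: "(base_orb \<circ> fst) z = (base_orb \<circ> fst) z'"
    if z: "z \<in> topspace E" "z' \<in> topspace E" "orb z = orb z'" for z z'
  proof -
    obtain \<sigma> where "\<sigma> permutes {..<n}" "z' = translate \<sigma> z"
      using orb_eqD[OF z(2,3)] .
    then show ?thesis
      using base_orb_act[OF E_D(1)[OF z(1)]] by (simp add: translate_def)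
  qed
  show "continuous_map Y B proj"
    unfolding proj_def by (rule continuous_map_inv_into_quotient(1)[OF quotient_orb c]) (rule compat)
  assume z: "z \<in> topspace E"
  have "((base_orb \<circ> fst) \<circ> inv_into (topspace E) orb) (orb z) = (base_orb \<circ> fst) z"
    by (rule continuous_map_inv_into_quotient(2)[OF quotient_orb c _ z]) (rule compat)
  then show "proj (orb z) = base_orb (fst z)"
    by (simp only: proj_def o_apply)
qed

lemma constant_in: "p \<in> topspace (P n) \<Longrightarrow> (p, \<lambda>i\<in>{..<n}. x0) \<in> topspace E"
  using x0_in by auto

lemma sect: "continuous_map B Y sect"
  "p \<in> topspace (P n) \<Longrightarrow> sect (base_orb p) = orb (p, \<lambda>i\<in>{..<n}. x0)"
proof -
  have "continuous_map (P n) E (\<lambda>p. (p, \<lambda>i\<in>{..<n}. x0))"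
    using x0_in by (intro continuous_map_into_k_prod_power k_space) auto
  from continuous_map_compose[OF this quotient_imp_continuous_map[OF quotient_orb]]
  have c: "continuous_map (P n) Y (\<lambda>p. orb (p, \<lambda>i\<in>{..<n}. x0))"
    by (simp add: o_def)
  have compat: "orb (p, \<lambda>i\<in>{..<n}. x0) = orb (p', \<lambda>i\<in>{..<n}. x0)"
    if p: "p \<in> topspace (P n)" "p' \<in> topspace (P n)" "base_orb p = base_orb p'" for p p'
  proof -
    obtain \<sigma> where \<sigma>: "\<sigma> permutes {..<n}" "p' = act n p \<sigma>"
      using base_orb_eqD[OF p(2,3)] by blast
    \<comment> \<open>A constant tuple is fixed by every permutation, so \<open>translate\<close>
      changes only the operad coordinate.\<close>
    have "(\<lambda>i\<in>{..<n}. x0) \<circ> \<sigma> = (\<lambda>i\<in>{..<n}. x0)"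
      using permutes_in_image[OF \<sigma>(1)] by (auto simp: fun_eq_iff restrict_def)
    then have "translate \<sigma> (p, \<lambda>i\<in>{..<n}. x0) = (p', \<lambda>i\<in>{..<n}. x0)"
      by (simp add: translate_def \<sigma>(2))
    then show ?thesis
      using orb_translate[OF constant_in[OF p(1)] \<sigma>(1)] by simp
  qed
  show "continuous_map B Y sect"
    unfolding sect_def by (rule continuous_map_inv_into_quotient(1)[OF quotient_base_orb c]) (rule compat)
  assume p: "p \<in> topspace (P n)"
  show "sect (base_orb p) = orb (p, \<lambda>i\<in>{..<n}. x0)"
    unfolding sect_def
    by (rule continuous_map_inv_into_quotient(2)[OF quotient_base_orb c _ p]) (rule compat)
qed

definition orbit_weight :: "(nat \<Rightarrow> 'a set) \<Rightarrow> ('p \<times> (nat \<Rightarrow> 'x)) set \<Rightarrow> real" where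
  "orbit_weight \<tau> = (\<lambda>z. sym_weight n \<tau> (snd z)) \<circ> inv_into (topspace E) orb"

lemma orbit_weight_orb: "z \<in> topspace E \<Longrightarrow> orbit_weight \<tau> (orb z) = sym_weight n \<tau> (snd z)"
  and continuous_map_orbit_weight:
    "\<tau> \<in> labellings n \<Longrightarrow> continuous_map Y euclideanreal (orbit_weight \<tau>)"
proof -
  have compat: "sym_weight n \<tau> (snd z) = sym_weight n \<tau> (snd z')"
    if "z \<in> topspace E" "z' \<in> topspace E" "orb z = orb z'" for z z'
    using orb_eqD[OF that(2,3)] sym_weight_compose by (metis snd_conv translate_def)
  show "orbit_weight \<tau> (orb z) = sym_weight n \<tau> (snd z)" if "z \<in> topspace E"
    unfolding orbit_weight_def o_def
    by (rule compat) (use that in \<open>auto simp: inv_into_into f_inv_into_f simp del: topspace_k_prod_power\<close>)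
  show "continuous_map Y euclideanreal (orbit_weight \<tau>)" if "\<tau> \<in> labellings n"
    unfolding orbit_weight_def
    by (rule continuous_map_inv_into_quotient(1)[OF quotient_orb continuous_map_sym_weight[OF that]])
      (rule compat)
qed

section \<open>The contractible cover of the balanced power\<close>

lemma topspace_Y: "topspace Y = orb ` topspace E"
  using quotient_imp_surjective_map[OF quotient_orb] by simp

text \<open>By equivariance the contraction followed by \<open>orb\<close> is constant on orbits at
  each time. It joins the identity to \<open>[p, x] \<mapsto> [p, x0, \<dots>, x0]\<close>, which is
  \<open>sect \<circ> proj\<close>.\<close>

lemma homotopic_id_sect_proj:
  assumes \<tau>: "\<tau> \<in> labellings n" and W: "openin Y W" and pos: "\<And>y. y \<in> W \<Longrightarrow> 0 < orbit_weight \<tau> y"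
  shows "homotopic_with (\<lambda>_. True) (subtopology Y W) Y id (sect \<circ> proj)"
proof -
  define V where "V = {z \<in> topspace E. orb z \<in> W}"
  have V: "openin E V"
    unfolding V_def using quotient_imp_continuous_map[OF quotient_orb] W
    by (rule openin_continuous_map_preimage)
  have VE: "z \<in> topspace E" and VW: "orb z \<in> W" if "z \<in> V" for z
    using that by (simp_all only: V_def mem_Collect_eq)
  have Vpos: "0 < sym_weight n \<tau> (snd z)" if "z \<in> V" for z
    using pos[OF VW[OF that]] orbit_weight_orb[OF VE[OF that]] by simp
  have tV: "topspace (subtopology E V) = V"
    using openin_subset[OF V] by (rule topspace_subtopology_subset)
  \<comment> \<open>\<open>V\<close> is the full preimage of the open set \<open>W\<close>, so the
    restriction of \<open>orb\<close> is still a quotient map.\<close>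
  have q: "quotient_map (subtopology E V) (subtopology Y W) orb"
    using W by (intro quotient_map_restriction[OF quotient_orb]) (auto simp: V_def)
  show ?thesis
  proof (rule homotopic_with_quotient_map[OF q, where h = "orb \<circ> contraction \<tau>"])
    show "continuous_map (prod_topology (top_of_set {0..1}) (subtopology E V)) Y (orb \<circ> contraction \<tau>)"
      using continuous_map_contraction[OF \<tau> V Vpos] quotient_imp_continuous_map[OF quotient_orb]
      by (rule continuous_map_compose)
    fix t :: real and z z'
    assume "t \<in> {0..1}" "z \<in> topspace (subtopology E V)" "z' \<in> topspace (subtopology E V)" "orb z = orb z'"
    then have z: "t \<in> {0..1}" "z \<in> V" "z' \<in> V" "orb z = orb z'"
      by (simp_all only: tV)
    obtain \<sigma> where \<sigma>: "\<sigma> permutes {..<n}" "z' = translate \<sigma> z"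
      using orb_eqD[OF VE[OF z(3)] z(4)] .
    show "(orb \<circ> contraction \<tau>) (t, z) = (orb \<circ> contraction \<tau>) (t, z')"
      using contraction_translate[OF \<tau> VE[OF z(2)] Vpos[OF z(2)] \<sigma>(1)]
        orb_translate[OF contraction_in[OF \<tau> VE[OF z(2)] Vpos[OF z(2)] z(1)] \<sigma>(1)]
      by (simp add: \<sigma>(2))
  next
    fix z assume "z \<in> topspace (subtopology E V)"
    then have z: "z \<in> V"
      by (simp only: tV)
    show "(orb \<circ> contraction \<tau>) (0, z) = id (orb z)"
      "(orb \<circ> contraction \<tau>) (1, z) = (sect \<circ> proj) (orb z)"
      using contraction_ends[OF \<tau> VE[OF z] Vpos[OF z]] proj(2)[OF VE[OF z]] sect(2)[OF E_D(1)[OF VE[OF z]]]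
      by simp_all
  qed
qed

text \<open>The cover consists of the sets of positivity of products of an orbit weight with a
  function pulled back from the partition on \<open>B\<close>. Such a set deforms into the section,
  where the contraction given in \<open>B\<close> finishes the nullhomotopy.\<close>

lemma Dold_space_balanced_power:
  assumes "Dold_space B"
  shows "Dold_space Y"
proof -
  obtain J :: "'p set set set" and g
    where g_cont: "\<And>j. j \<in> J \<Longrightarrow> continuous_map B euclideanreal (g j)"
      and g_nonneg: "\<And>j u. j \<in> J \<Longrightarrow> u \<in> topspace B \<Longrightarrow> 0 \<le> g j u"
      and g_sum: "\<And>u. u \<in> topspace B \<Longrightarrow> (\<Sum>j | j \<in> J \<and> g j u \<noteq> 0. g j u) = 1"
      and g_lf: "locally_finite_supports B J g"
      and g_ac: "\<And>j. j \<in> J \<Longrightarrow> ambiently_contractible B {u \<in> topspace B. 0 < g j u}"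
    using Dold_space_partition[OF assms] by blast
  define F where "F = (\<lambda>(\<tau>, j) y. orbit_weight \<tau> y * g j (proj y))"
  have proj_in: "proj y \<in> topspace B" if "y \<in> topspace Y" for y
    using that continuous_map_image_subset_topspace[OF proj(1)] by blast
  have ow_nonneg: "0 \<le> orbit_weight \<tau> y" for \<tau> y
    by (simp add: orbit_weight_def sym_weight_nonneg)
  have gproj: "continuous_map Y euclideanreal (\<lambda>y. g j (proj y))" if "j \<in> J" for j
    using continuous_map_compose[OF proj(1) g_cont[OF that]] by (simp add: o_def)
  show ?thesis
  proof (rule Dold_space_cozero[where I = "labellings n \<times> J" and f = F])
    fix k assume "k \<in> labellings n \<times> J"
    then obtain \<tau> j where k: "k = (\<tau>, j)" "\<tau> \<in> labellings n" "j \<in> J" by blast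
    show cF: "continuous_map Y euclideanreal (F k)"
      using continuous_map_real_mult[OF continuous_map_orbit_weight[OF k(2)] gproj[OF k(3)]]
      by (simp add: F_def k(1))
    show "0 \<le> F k y" if "y \<in> topspace Y" for y
      using that ow_nonneg g_nonneg[OF k(3) proj_in] by (simp add: F_def k(1))
    let ?W = "{y \<in> topspace Y. 0 < F k y}" and ?U = "{u \<in> topspace B. 0 < g j u}"
    have W: "openin Y ?W"
      using openin_continuous_map_preimage[OF cF, of "{0<..}"] by simp
    have Wpos: "0 < orbit_weight \<tau> y" "proj y \<in> ?U" if "y \<in> ?W" for y
      using that ow_nonneg[of \<tau> y] g_nonneg[OF k(3) proj_in, of y] proj_in[of y]
      by (auto simp: F_def k(1) zero_less_mult_iff)
    obtain a where "homotopic_with (\<lambda>_. True) (subtopology B ?U) B id (\<lambda>_. a)"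
      using g_ac[OF k(3)] unfolding ambiently_contractible_def by blast
    moreover have "continuous_map (subtopology Y ?W) (subtopology B ?U) proj"
      unfolding continuous_map_in_subtopology
      using continuous_map_from_subtopology[OF proj(1)] Wpos(2) by auto
    ultimately have "homotopic_with (\<lambda>_. True) (subtopology Y ?W) B (id \<circ> proj) ((\<lambda>_. a) \<circ> proj)"
      by (rule homotopic_with_compose_continuous_map_right) simp
    \<comment> \<open>The contraction in \<open>B\<close> is carried into \<open>Y\<close> along the
      section; it starts at \<open>sect \<circ> proj\<close>, where the first deformation
      ends.\<close>
    then have "homotopic_with (\<lambda>_. True) (subtopology Y ?W) Y (sect \<circ> (id \<circ> proj)) (sect \<circ> ((\<lambda>_. a) \<circ> proj))"
      by (rule homotopic_with_compose_continuous_map_left[OF _ sect(1)]) simp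
    moreover have "homotopic_with (\<lambda>_. True) (subtopology Y ?W) Y id (sect \<circ> proj)"
      using homotopic_id_sect_proj[OF k(2) W] Wpos(1) by blast
    ultimately have "homotopic_with (\<lambda>_. True) (subtopology Y ?W) Y id (\<lambda>_. sect a)"
      using homotopic_with_trans by (fastforce simp: o_def)
    then show "ambiently_contractible Y ?W"
      unfolding ambiently_contractible_def by blast
  next
    show "locally_finite_supports Y (labellings n \<times> J) F"
      unfolding locally_finite_supports_def
    proof
      fix y assume y: "y \<in> topspace Y"
      then obtain z where z: "z \<in> topspace E" "y = orb z"
        unfolding topspace_Y by blast
      obtain U where U: "openin B U" "proj y \<in> U" "finite {j \<in> J. \<exists>u\<in>U. g j u \<noteq> 0}"
        using g_lf proj_in[OF y] unfolding locally_finite_supports_def by blast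
      have "\<forall>i\<in>{..<n}. \<exists>V. openin X V \<and> snd z i \<in> V \<and> finite {a \<in> A. \<exists>x\<in>V. f a x \<noteq> 0}"
        using f_locally_finite E_D(3)[OF z(1)] unfolding locally_finite_supports_def by blast
      then obtain V where V: "\<forall>i\<in>{..<n}. openin X (V i) \<and> snd z i \<in> V i \<and> finite {a \<in> A. \<exists>x\<in>V i. f a x \<noteq> 0}"
        by (rule bchoice[THEN exE])
      \<comment> \<open>\<open>S\<close> collects the finitely many indices active near some
        coordinate of \<open>z\<close>. A labelling whose weight is nonzero at an orbit through
        \<open>N\<close> has all its label sets inside \<open>S\<close>, which leaves finitely many
        labellings.\<close>
      define S where "S = (\<Union>i\<in>{..<n}. {a \<in> A. \<exists>x\<in>V i. f a x \<noteq> 0})"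
      define N where "N = {z \<in> topspace E. \<forall>i\<in>{..<n}. snd z i \<in> V i}"
      define M where "M = orb ` N \<inter> {y \<in> topspace Y. proj y \<in> U}"
      \<comment> \<open>Intersecting with \<open>topspace E\<close> covers the case
        \<open>n = 0\<close>, where the indexed intersection is the whole type.\<close>
      have "N = topspace E \<inter> (\<Inter>i\<in>{..<n}. {z \<in> topspace E. snd z i \<in> V i})"
        by (auto simp: N_def)
      moreover have "openin E {z \<in> topspace E. snd z i \<in> V i}" if "i \<in> {..<n}" for i
        using that V by (intro openin_continuous_map_preimage[OF continuous_map_k_prod_coordinate]) auto
      ultimately have "openin E N"
        by (cases "n = 0") (auto intro!: openin_Int openin_INT simp del: topspace_k_prod_power)
      then have "openin Y (orb ` N)"
        using open_map_orb unfolding open_map_def by blast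
      moreover have "openin Y {y \<in> topspace Y. proj y \<in> U}"
        using proj(1) U(1) by (rule openin_continuous_map_preimage)
      ultimately have M: "openin Y M"
        unfolding M_def by (rule openin_Int)
      have yM: "y \<in> M"
        using y z U(2) V unfolding M_def N_def by auto
      have "finite S"
        unfolding S_def using V by blast
      then have fin: "finite ((\<Pi>\<^sub>E i\<in>{..<n}. Pow S) \<times> {j \<in> J. \<exists>u\<in>U. g j u \<noteq> 0})"
        using U(3) by (intro finite_SigmaI finite_PiE) auto
      have "{k \<in> labellings n \<times> J. \<exists>y\<in>M. F k y \<noteq> 0} \<subseteq>
          (\<Pi>\<^sub>E i\<in>{..<n}. Pow S) \<times> {j \<in> J. \<exists>u\<in>U. g j u \<noteq> 0}"
      proof
        fix k assume "k \<in> {k \<in> labellings n \<times> J. \<exists>y\<in>M. F k y \<noteq> 0}"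
        then obtain \<tau> j y' where k: "k = (\<tau>, j)" "\<tau> \<in> labellings n" "j \<in> J" "y' \<in> M"
          "orbit_weight \<tau> y' \<noteq> 0" "g j (proj y') \<noteq> 0"
          by (auto simp: F_def)
        obtain w where w: "w \<in> N" "y' = orb w" and pU: "proj y' \<in> U"
          using k(4) by (auto simp: M_def)
        have wE: "w \<in> topspace E"
          using w(1) by (simp only: N_def mem_Collect_eq)
        have "0 < sym_weight n \<tau> (snd w)"
          using k(5) sym_weight_nonneg[of n \<tau> "snd w"] orbit_weight_orb[OF wE] w(2) by simp
        then obtain \<sigma> where \<sigma>: "\<sigma> permutes {..<n}" "0 < weight n (\<tau> \<circ> \<sigma>) (snd w)"
          by (auto simp: sym_weight_pos_iff)
        have "\<tau> i \<subseteq> S" if i: "i < n" for i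
        proof
          fix a assume a: "a \<in> \<tau> i"
          \<comment> \<open>The coordinate at which the translate
            \<open>\<tau> \<circ> \<sigma>\<close> carries the label set
            \<open>\<tau> i\<close>.\<close>
          define m where "m = inv \<sigma> i"
          have m: "m < n" "\<sigma> m = i"
            using permutes_in_image[OF permutes_inv[OF \<sigma>(1)], of i] i permutes_inverses(1)[OF \<sigma>(1)]
            by (auto simp: m_def)
          have "0 < f a (snd w m)"
            using weight_pos_imp[OF labellings_compose[OF k(2) \<sigma>(1)] E_D(2)[OF wE] \<sigma>(2) m(1), of a] a m(2)
            by simp
          moreover have "snd w m \<in> V m"
            using w(1) m(1) by (simp add: N_def)
          ultimately have "\<exists>x\<in>V m. f a x \<noteq> 0"
            by (metis less_irrefl)
          moreover have "a \<in> A"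
            using labellingsD(3)[OF k(2) i] a by blast
          ultimately show "a \<in> S"
            unfolding S_def using m(1) by blast
        qed
        then have "\<tau> \<in> (\<Pi>\<^sub>E i\<in>{..<n}. Pow S)"
          using k(2) by (auto simp: labellings_def PiE_iff)
        then show "k \<in> (\<Pi>\<^sub>E i\<in>{..<n}. Pow S) \<times> {j \<in> J. \<exists>u\<in>U. g j u \<noteq> 0}"
          using k pU by blast
      qed
      then have "finite {k \<in> labellings n \<times> J. \<exists>y\<in>M. F k y \<noteq> 0}"
        using fin by (rule finite_subset)
      with M yM show "\<exists>V. openin Y V \<and> y \<in> V \<and> finite {k \<in> labellings n \<times> J. \<exists>y\<in>V. F k y \<noteq> 0}"
        by (intro exI[of _ M] conjI)
    qed
  next
    fix y assume y: "y \<in> topspace Y"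
    then obtain z where z: "z \<in> topspace E" "y = orb z"
      unfolding topspace_Y by blast
    obtain \<tau> where \<tau>: "\<tau> \<in> labellings n" "0 < weight n \<tau> (snd z)"
      using weight_pos_ex[OF E_D(2)[OF z(1)]] by blast
    then have "0 < sym_weight n \<tau> (snd z)"
      unfolding sym_weight_pos_iff by (intro exI[of _ id]) (simp add: permutes_id)
    then have 1: "0 < orbit_weight \<tau> y"
      using orbit_weight_orb[OF z(1)] z(2) by simp
    have "(\<Sum>j | j \<in> J \<and> g j (proj y) \<noteq> 0. g j (proj y)) \<noteq> 0"
      using g_sum[OF proj_in[OF y]] by simp
    then obtain j where j: "j \<in> J" "g j (proj y) \<noteq> 0"
      by (elim sum.not_neutral_contains_not_neutral) blast
    then have "0 < g j (proj y)"
      using g_nonneg[OF j(1) proj_in[OF y]] by simp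
    then show "\<exists>k\<in>labellings n \<times> J. 0 < F k y"
      using 1 \<tau>(1) j(1) by (intro bexI[of _ "(\<tau>, j)"]) (auto simp: F_def)
  qed
qed

end

section \<open>Contractions to a common point, and the coproduct\<close>

lemma Dold_space_contractions:
  fixes X :: "'x topology"
  assumes X: "Dold_space X" and pc: "path_connected_space X" and x0: "topspace X \<noteq> {} \<Longrightarrow> x0 \<in> topspace X"
  obtains A :: "'x set set" and f h where "contracting_partition X A f h x0"
proof -
  obtain A :: "'x set set" and f
    where f: "\<And>a. a \<in> A \<Longrightarrow> continuous_map X euclideanreal (f a)"
      "\<And>a x. a \<in> A \<Longrightarrow> x \<in> topspace X \<Longrightarrow> 0 \<le> f a x"
      "\<And>x. x \<in> topspace X \<Longrightarrow> (\<Sum>a | a \<in> A \<and> f a x \<noteq> 0. f a x) = 1"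
      "locally_finite_supports X A f"
      and ac: "\<And>a. a \<in> A \<Longrightarrow> ambiently_contractible X {x \<in> topspace X. 0 < f a x}"
    using Dold_space_partition[OF X] by blast
  have "\<forall>a\<in>A. \<exists>h. continuous_map (prod_topology (top_of_set {0..1::real}) (subtopology X {x \<in> topspace X. 0 < f a x})) X h \<and>
      (\<forall>x\<in>topspace X. 0 < f a x \<longrightarrow> h (0, x) = x \<and> h (1, x) = x0)"
  proof
    fix a assume a: "a \<in> A"
    let ?U = "subtopology X {x \<in> topspace X. 0 < f a x}"
    obtain c where c: "homotopic_with (\<lambda>_. True) ?U X id (\<lambda>_. c)"
      using ac[OF a] unfolding ambiently_contractible_def by blast
    \<comment> \<open>Path connectedness moves the endpoint \<open>c\<close> of each contraction to
      the common point \<open>x0\<close>.\<close>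
    have "homotopic_with (\<lambda>_. True) ?U X (\<lambda>_. c) (\<lambda>_. x0)"
    proof (cases "topspace ?U = {}")
      \<comment> \<open>On an empty domain the two constant maps are homotopic even if
        \<open>c\<close> lies outside \<open>X\<close>.\<close>
      case True
      then have "?U = trivial_topology"
        by (simp only: null_topspace_iff_trivial)
      then show ?thesis
        by (simp only: homotopic_constant_maps simp_thms)
    next
      case False
      then obtain y where y: "y \<in> topspace ?U" by blast
      have "c \<in> topspace X"
        using continuous_map_image_subset_topspace[OF conjunct2[OF homotopic_with_imp_continuous_maps[OF c]]] y
        by blast
      moreover have "x0 \<in> topspace X"
        by (rule x0) (use y in auto)
      ultimately show ?thesis
        using pc by (simp add: homotopic_constant_maps path_connected_space_iff_path_component)
    qed
    with c have "homotopic_with (\<lambda>_. True) ?U X id (\<lambda>_. x0)"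
      by (rule homotopic_with_trans)
    then show "\<exists>h. continuous_map (prod_topology (top_of_set {0..1::real}) ?U) X h \<and>
        (\<forall>x\<in>topspace X. 0 < f a x \<longrightarrow> h (0, x) = x \<and> h (1, x) = x0)"
      by (auto simp: homotopic_with)
  qed
  then obtain h where h: "\<forall>a\<in>A. continuous_map (prod_topology (top_of_set {0..1::real}) (subtopology X {x \<in> topspace X. 0 < f a x})) X (h a) \<and>
      (\<forall>x\<in>topspace X. 0 < f a x \<longrightarrow> h a (0, x) = x \<and> h a (1, x) = x0)"
    by (rule bchoice[THEN exE])
  have "contracting_partition X A f h x0"
  proof
    fix a assume a: "a \<in> A"
    show "continuous_map X euclideanreal (f a)"
      by (rule f(1)[OF a])
    show "continuous_map (prod_topology (top_of_set {0..1}) (subtopology X {x \<in> topspace X. 0 < f a x})) X (h a)"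
      using bspec[OF h a] by (rule conjunct1)
    fix x assume x: "x \<in> topspace X"
    show "0 \<le> f a x"
      by (rule f(2)[OF a x])
    assume "0 < f a x"
    then show "h a (0, x) = x" "h a (1, x) = x0"
      using bspec[OF conjunct2[OF bspec[OF h a]] x] by simp_all
  qed (use f(3,4) in blast)+
  then show ?thesis
    by (rule that)
qed

theorem proposition5p3:
  fixes P :: "nat \<Rightarrow> 'p topology"
    and act :: "nat \<Rightarrow> 'p \<Rightarrow> (nat \<Rightarrow> nat) \<Rightarrow> 'p"
    and unit :: 'p
    and compo :: "nat list \<Rightarrow> 'p \<Rightarrow> (nat \<Rightarrow> 'p) \<Rightarrow> 'p"
    and X :: "'x topology"
  assumes "topological_operad P act unit compo"
    and "\<And>n. Dold_space (sym_orbit_space P act n)"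
    and "is_k_space X" and "path_connected_space X" and "Dold_space X"
  shows "Dold_space (free_operad_space P act X)"
  unfolding free_operad_space_def
proof (rule Dold_space_sum_topology)
  fix n
  show "Dold_space (balanced_power P act X n)"
  proof (cases "0 < n \<and> topspace X = {}")
    \<comment> \<open>With no points in \<open>X\<close> and \<open>n\<close> positive the balanced
      power is empty, and the empty family of functions serves.\<close>
    case True
    then have "topspace (balanced_power P act X n) = {}"
      by (auto simp: balanced_power_def PiE_eq_empty_iff)
    then show ?thesis
      by (intro Dold_space_cozero[where I = "{}" and f = undefined])
        (auto simp: locally_finite_supports_def)
  next
    case False
    \<comment> \<open>Here \<open>X\<close> is nonempty or \<open>n = 0\<close>; an empty
      \<open>X\<close> leaves \<open>x0\<close> arbitrary.\<close>
    obtain x0 where x0: "topspace X \<noteq> {} \<Longrightarrow> x0 \<in> topspace X"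
      by blast
    obtain A :: "'x set set" and f h where "contracting_partition X A f h x0"
      using Dold_space_contractions[OF assms(5,4) x0] by blast
    then have "operad_partition P act unit compo X A f h x0 n"
      using assms(1) False x0 by (intro operad_partition.intro operad_partition_axioms.intro) auto
    then show ?thesis
      using assms(2) by (rule operad_partition.Dold_space_balanced_power)
  qed
qed

end
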